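(* The process $\widetilde S_h$ admits a continuous modification. Moreover, if $h$ is Hölder continuous, then for every $t_0\in[0,\infty)$ the pointwise Hölder exponent $\alpha_{\widetilde S_h}(t_0)$ of $\widetilde S_h$ at $t_0$ (computed for the continuous modification) is almost surely equal to $h(t_0)$.
   Context: Let $1/2<a\le b<1$, let $h:\mathbb{R}\to[a,b]$ be continuous, and let $R:[a,b]^2\to(0,\infty)$ be the continuous function associated with a centered Gaussian field $X=\{X_n(H):H\in(1/2,1),n\in\mathbb{N}\}$ satisfying: (i) for every $M>0$, the map $(j,k,H_1,H_2)\mapsto\mathbb{E}[X_j(H_1)X_k(H_2)]$ is bounded on $\{(j,k)\in\mathbb{N}^2:|j-k|\le M\}\times[a,b]^2$; (ii) $\lim_{j-k\to\infty}\sup_{(H_1,H_2)\in[a,b]^2}\left|(j-k)^{2-H_1-H_2}\mathbb{E}[X_j(H_1)X_k(H_2)]-R(H_1,H_2)\right|=0$. Put $\mathcal{R}(t,s;H_1,H_2)=R(H_1,H_2)\mathbf 1_{t\ge s}+R(H_2,H_1)\mathbf 1_{t<s}$. The process $\widetilde S_h=\{\widetilde S_h(t)\}_{t\ge0}$ is the limit, in the sense of finite-dimensional distributions as $N\to\infty$, of $S_h^N(t)=\sum_{n=1}^{\lfloor Nt\rfloor}N^{-h(n/N)}X_n(h(n/N))$; it is the centered Gaussian process with covariance $$\mathbb{E}[\widetilde S_h(t)\widetilde S_h(s)]=\int_0^t d\theta\int_0^s d\sigma\,\mathcal{R}(\theta,\sigma;h(\theta),h(\sigma))|\theta-\sigma|^{h(\theta)+h(\sigma)-2},\qquad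 t,s\ge0.$$ The pointwise Hölder exponent of a continuous function $f:[0,\infty)\to\mathbb{R}$ at $t_0$ is $\alpha_f(t_0)=\sup\{\alpha\in[0,1]:\lim_{t\to t_0,\,t\neq t_0,\,t\ge 0}|f(t)-f(t_0)|/|t-t_0|^{\alpha}=0\}$ (with $\sup\emptyset=0$). *)

theory Defs
  imports "HOL-Probability.Probability"
begin

definition centered_normal_rv :: "'a measure \<Rightarrow> ('a \<Rightarrow> real) \<Rightarrow> bool" where
  \<comment> \<open>the degenerate law, of variance 0, is included\<close>
  "centered_normal_rv M Y \<longleftrightarrow> Y \<in> borel_measurable M \<and>
     ((AE \<omega> in M. Y \<omega> = 0) \<or> (\<exists>\<sigma>>0. distributed M lborel Y (normal_density 0 \<sigma>)))"

definition centered_gaussian_process :: "'a measure \<Rightarrow> 'i set \<Rightarrow> ('i \<Rightarrow> 'a \<Rightarrow> real) \<Rightarrow> bool" where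
  "centered_gaussian_process M I Y \<longleftrightarrow>
     (\<forall>F c. finite F \<and> F \<subseteq> I \<longrightarrow> centered_normal_rv M (\<lambda>\<omega>. \<Sum>i\<in>F. c i * Y i \<omega>))"

text \<open>Convergence of finite-dimensional distributions. A random vector indexed by a finite set
  \<open>F\<close> is extended by 0 outside \<open>F\<close>; this embeds \<open>\<real>\<^sup>F\<close> as a closed subspace and retract of the
  product space \<open>'i \<Rightarrow> real\<close>, so that the bounded continuous functions on \<open>\<real>\<^sup>F\<close> are exactly
  the restrictions of those on the product space.\<close>

definition fdd_converges ::
  "'a measure \<Rightarrow> (nat \<Rightarrow> 'i \<Rightarrow> 'a \<Rightarrow> real) \<Rightarrow> 'b measure \<Rightarrow> ('i \<Rightarrow> 'b \<Rightarrow> real) \<Rightarrow> 'i set \<Rightarrow> bool" where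
  "fdd_converges M Y P Z I \<longleftrightarrow>
     (\<forall>F (f :: ('i \<Rightarrow> real) \<Rightarrow> real). finite F \<and> F \<subseteq> I \<and> continuous_on UNIV f \<and> bounded (range f) \<longrightarrow>
        (\<lambda>N. integral\<^sup>L M (\<lambda>\<omega>. f (\<lambda>i. if i \<in> F then Y N i \<omega> else 0)))
          \<longlonglongrightarrow> integral\<^sup>L P (\<lambda>\<omega>. f (\<lambda>i. if i \<in> F then Z i \<omega> else 0)))"

definition scaled_sum ::
  "(real \<Rightarrow> real) \<Rightarrow> (nat \<Rightarrow> real \<Rightarrow> 'a \<Rightarrow> real) \<Rightarrow> nat \<Rightarrow> real \<Rightarrow> 'a \<Rightarrow> real" where
  "scaled_sum h X N t \<omega> =
     (\<Sum>n = 1..nat \<lfloor>real N * t\<rfloor>. real N powr (- h (real n / real N)) * X n (h (real n / real N)) \<omega>)"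

definition R_sym :: "(real \<Rightarrow> real \<Rightarrow> real) \<Rightarrow> real \<Rightarrow> real \<Rightarrow> real \<Rightarrow> real \<Rightarrow> real" where
  "R_sym R t s H1 H2 = (if t \<ge> s then R H1 H2 else R H2 H1)"

definition limit_covariance ::
  "(real \<Rightarrow> real \<Rightarrow> real) \<Rightarrow> (real \<Rightarrow> real) \<Rightarrow> real \<Rightarrow> real \<Rightarrow> real" where
  "limit_covariance R h t s =
     (LINT \<theta>:{0..t}|lborel. LINT \<sigma>:{0..s}|lborel.
        R_sym R \<theta> \<sigma> (h \<theta>) (h \<sigma>) * \<bar>\<theta> - \<sigma>\<bar> powr (h \<theta> + h \<sigma> - 2))"

definition continuous_modification ::
  "'a measure \<Rightarrow> (real \<Rightarrow> 'a \<Rightarrow> real) \<Rightarrow> (real \<Rightarrow> 'a \<Rightarrow> real) \<Rightarrow> bool" where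
  "continuous_modification P S Y \<longleftrightarrow>
     (\<forall>t\<ge>0. Y t \<in> borel_measurable P \<and> (AE \<omega> in P. Y t \<omega> = S t \<omega>)) \<and>
     (\<forall>\<omega>\<in>space P. continuous_on {0..} (\<lambda>t. Y t \<omega>))"

definition hoelder_continuous :: "(real \<Rightarrow> real) \<Rightarrow> bool" where
  "hoelder_continuous h \<longleftrightarrow>
     (\<exists>\<gamma> C. 0 < \<gamma> \<and> \<gamma> \<le> 1 \<and> (\<forall>x y. \<bar>h x - h y\<bar> \<le> C * \<bar>x - y\<bar> powr \<gamma>))"

definition hoelder_orders :: "(real \<Rightarrow> real) \<Rightarrow> real \<Rightarrow> real set" where
  "hoelder_orders f t0 =
     {\<alpha>\<in>{0..1}. ((\<lambda>t. \<bar>f t - f t0\<bar> / \<bar>t - t0\<bar> powr \<alpha>) \<longlongrightarrow> 0) (at t0 within {0..})}"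

definition pointwise_hoelder_exponent :: "(real \<Rightarrow> real) \<Rightarrow> real \<Rightarrow> real" where
  "pointwise_hoelder_exponent f t0 =
     (if hoelder_orders f t0 = {} then 0 else Sup (hoelder_orders f t0))"

end

theory Submission
  imports Defs
begin

text \<open>
  The variance of an increment of the limit process over \<open>(s, t]\<close> is the double integral of the
  positive kernel over \<open>(s, t]\<^sup>2\<close>; since \<open>R\<close> is bounded above and away from 0, it lies, up to
  constants, between \<open>(t - s)\<close> to the power \<open>2 max h\<close> and to the power \<open>2 min h\<close> over \<open>[s, t]\<close>.
  High Gaussian moments turn the upper bound into Borel--Cantelli estimates for dyadic increments
  (Kolmogorov's criterion); chaining gives the continuous modification and, along the dyadic grid
  based at \<open>t0\<close>, the lower bound for the exponent. The lower variance bound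
  makes \<open>\<bar>S t - S t0\<bar> \<le> \<bar>t - t0\<bar> powr \<alpha>\<close> with \<open>\<alpha> > h t0\<close> improbable as \<open>t\<close> approaches \<open>t0\<close>, because
  Gaussian densities are bounded; this gives the upper bound. Continuity of \<open>h\<close> at \<open>t0\<close>
  closes the gap.
\<close>

subsection \<open>Centered normal variables\<close>

text \<open>The claim concerns every continuous modification \<open>Y\<close>, and at each fixed
  time \<open>Y\<close> agrees with \<open>S\<close> only almost surely. All probabilistic estimates
  are therefore made at countably many times (dyadic points, or \<open>t0 + (1/2) ^ n\<close>) and
  moved to \<open>Y\<close> there; path continuity extends the upper estimates to the remaining
  times. The grid is based at \<open>t0\<close>, and followed to the right and to the left
  separately, because the variance exponent close to \<open>h t0\<close> is available only on a
  small interval around \<open>t0\<close>. Hence the chaining lemmas speak of a function on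
  \<open>{0..\<rho>}\<close>. The limiting exponent is approached through sequences
  \<open>d k\<close> and \<open>e k\<close> tending to 0, so that only countably many null sets are
  discarded. Each of them is spent twice: once for the oscillation of \<open>h\<close> near
  \<open>t0\<close>, once for the gap between variance exponent and path exponent that the
  probabilistic argument demands. The condition \<open>1/2 < a\<close> enters as
  \<open>2 * a - 2 > -1\<close>: it makes the kernel integrable across the diagonal.\<close>

lemma centered_normal_even_moment:
  assumes "prob_space P" and D: "centered_normal_rv P D"
  shows "integrable P (\<lambda>\<omega>. D \<omega> ^ (2 * k))"
    and "(LINT \<omega>|P. D \<omega> ^ (2 * k)) = fact (2 * k) / (2 ^ k * fact k) * (LINT \<omega>|P. (D \<omega>)\<^sup>2) ^ k"
proof -
  interpret prob_space P by fact
  have [measurable]: "D \<in> borel_measurable P" using D by (simp add: centered_normal_rv_def)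
  have "integrable P (\<lambda>\<omega>. D \<omega> ^ (2 * k)) \<and>
    (LINT \<omega>|P. D \<omega> ^ (2 * k)) = fact (2 * k) / (2 ^ k * fact k) * (LINT \<omega>|P. (D \<omega>)\<^sup>2) ^ k"
  proof (cases "AE \<omega> in P. D \<omega> = 0")
    case True
    \<comment> \<open>The value is \<open>0 ^ k\<close> and not 0, since the moment of order 0 is 1
      also for the degenerate law.\<close>
    have eq: "AE \<omega> in P. D \<omega> ^ (2 * k) = 0 ^ k" for k
      using True by eventually_elim (auto simp: power_0_left)
    have "integrable P (\<lambda>\<omega>. D \<omega> ^ (2 * k))"
      by (rule integrable_cong_AE_imp[OF integrable_const[of "0 ^ k"]]) (use eq in \<open>auto simp: eq_commute\<close>)
    moreover have "(LINT \<omega>|P. D \<omega> ^ (2 * k)) = 0 ^ k" for k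
      using integral_cong_AE[OF _ _ eq[of k]] by (simp add: prob_space)
    from this[of k] this[of 1] have "(LINT \<omega>|P. D \<omega> ^ (2 * k)) = 0 ^ k" "(LINT \<omega>|P. (D \<omega>)\<^sup>2) = 0" by simp_all
    ultimately show ?thesis by (simp add: power_0_left)
  next
    case False
    then obtain \<sigma> where \<sigma>: "\<sigma> > 0" and d: "distributed P lborel D (normal_density 0 \<sigma>)"
      using D by (auto simp: centered_normal_rv_def)
    have m: "integrable P (\<lambda>\<omega>. D \<omega> ^ (2 * k)) \<and>
      (LINT \<omega>|P. D \<omega> ^ (2 * k)) = fact (2 * k) / ((2 / \<sigma>\<^sup>2) ^ k * fact k)" for k
      using normal_moment_even[OF \<sigma>, of 0 k]
        distributed_integrable[OF d, of "\<lambda>x. x ^ (2 * k)"] distributed_integral[OF d, of "\<lambda>x. x ^ (2 * k)"]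
      by (auto simp: has_bochner_integral_iff)
    from m[of 1] have "(LINT \<omega>|P. (D \<omega>)\<^sup>2) = \<sigma>\<^sup>2" by simp
    then show ?thesis using m[of k] by (simp add: power_divide)
  qed
  then show "integrable P (\<lambda>\<omega>. D \<omega> ^ (2 * k))"
    "(LINT \<omega>|P. D \<omega> ^ (2 * k)) = fact (2 * k) / (2 ^ k * fact k) * (LINT \<omega>|P. (D \<omega>)\<^sup>2) ^ k" by auto
qed

text \<open>Markov's inequality for \<open>D ^ (2 * k)\<close>; the factor is the double factorial
  (2k-1)!!. The order \<open>k\<close> stays free, because it must later outweigh the number of
  dyadic intervals.\<close>

lemma centered_normal_tail:
  assumes P: "prob_space P" and D: "centered_normal_rv P D"
    and v: "(LINT \<omega>|P. (D \<omega>)\<^sup>2) \<le> v" and x: "x > 0"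
  shows "measure P {\<omega>\<in>space P. x < \<bar>D \<omega>\<bar>} \<le> fact (2 * k) / (2 ^ k * fact k) * (v / x\<^sup>2) ^ k"
proof -
  interpret prob_space P by fact
  have [measurable]: "D \<in> borel_measurable P" using D by (simp add: centered_normal_rv_def)
  have "measure P {\<omega>\<in>space P. x < \<bar>D \<omega>\<bar>} \<le> measure P {\<omega>\<in>space P. x ^ (2 * k) \<le> D \<omega> ^ (2 * k)}"
  proof (rule finite_measure_mono)
    have "x ^ (2 * k) \<le> y ^ (2 * k)" if "x < \<bar>y\<bar>" for y
      using power_mono[of x "\<bar>y\<bar>" "2 * k"] that x by (simp add: power_even_abs)
    then show "{\<omega>\<in>space P. x < \<bar>D \<omega>\<bar>} \<subseteq> {\<omega>\<in>space P. x ^ (2 * k) \<le> D \<omega> ^ (2 * k)}" by auto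
  qed measurable
  also have "\<dots> \<le> (LINT \<omega>|P. D \<omega> ^ (2 * k)) / x ^ (2 * k)"
    by (rule integral_Markov_inequality_measure[where A="space P"])
       (use centered_normal_even_moment(1)[OF P D] x in auto)
  also have "\<dots> = fact (2 * k) / (2 ^ k * fact k) * ((LINT \<omega>|P. (D \<omega>)\<^sup>2) / x\<^sup>2) ^ k"
    by (subst centered_normal_even_moment(2)[OF P D]) (simp add: power_divide power_mult)
  also have "\<dots> \<le> fact (2 * k) / (2 ^ k * fact k) * (v / x\<^sup>2) ^ k"
    using v x by (intro mult_left_mono power_mono divide_right_mono) auto
  finally show ?thesis .
qed

text \<open>The density is at most \<open>1 / (2 * \<sigma>)\<close> and the interval has length
  \<open>2 * x\<close>. A positive lower bound on the variance rules out the degenerate law.\<close>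

lemma centered_normal_small_ball:
  assumes P: "prob_space P" and D: "centered_normal_rv P D"
    and v: "v \<le> (LINT \<omega>|P. (D \<omega>)\<^sup>2)" "v > 0" and x: "x \<ge> 0"
  shows "measure P {\<omega>\<in>space P. \<bar>D \<omega>\<bar> \<le> x} \<le> x / sqrt v"
proof -
  interpret prob_space P by fact
  have [measurable]: "D \<in> borel_measurable P" using D by (simp add: centered_normal_rv_def)
  have "\<not> (AE \<omega> in P. D \<omega> = 0)"
  proof
    assume "AE \<omega> in P. D \<omega> = 0"
    then have "AE \<omega> in P. (D \<omega>)\<^sup>2 = 0" by eventually_elim simp
    then have "(LINT \<omega>|P. (D \<omega>)\<^sup>2) = 0" by (simp add: integral_eq_zero_AE)
    then show False using v by simp
  qed
  then obtain \<sigma> where \<sigma>: "\<sigma> > 0" and d: "distributed P lborel D (normal_density 0 \<sigma>)"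
    using D by (auto simp: centered_normal_rv_def)
  have "(LINT \<omega>|P. (D \<omega>)\<^sup>2) = \<sigma>\<^sup>2"
    using normal_moment_even[OF \<sigma>, of 0 1] distributed_integral[OF d, of "\<lambda>x. x\<^sup>2"]
    by (auto simp: has_bochner_integral_iff)
  then have v\<sigma>: "sqrt v \<le> \<sigma>" using v \<sigma> real_le_lsqrt by force
  have dens: "normal_density 0 \<sigma> y \<le> 1 / (2 * \<sigma>)" for y
  proof -
    \<comment> \<open>Squared, this is \<open>4 \<le> 2 * pi\<close>.\<close>
    have "2 * \<sigma> \<le> sqrt (2 * pi * \<sigma>\<^sup>2)"
      using \<sigma> pi_ge_two by (intro real_le_rsqrt) (auto simp: power_mult_distrib)
    then have "1 / sqrt (2 * pi * \<sigma>\<^sup>2) \<le> 1 / (2 * \<sigma>)" using \<sigma> by (intro divide_left_mono) auto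
    moreover have "exp (- (y\<^sup>2) / (2 * \<sigma>\<^sup>2)) \<le> 1" by simp
    ultimately have "1 / sqrt (2 * pi * \<sigma>\<^sup>2) * exp (- (y\<^sup>2) / (2 * \<sigma>\<^sup>2)) \<le> 1 / (2 * \<sigma>) * 1"
      by (intro mult_mono) (use \<sigma> in auto)
    then show ?thesis by (simp add: normal_density_def)
  qed
  have "{\<omega>\<in>space P. \<bar>D \<omega>\<bar> \<le> x} = D -` {-x..x} \<inter> space P" by auto
  then have "emeasure P {\<omega>\<in>space P. \<bar>D \<omega>\<bar> \<le> x} = (\<integral>\<^sup>+y. ennreal (normal_density 0 \<sigma> y) * indicator {-x..x} y \<partial>lborel)"
    using distributed_emeasure[OF d, of "{-x..x}"] by simp
  also have "\<dots> \<le> (\<integral>\<^sup>+y. ennreal (1 / (2 * \<sigma>)) * indicator {-x..x} y \<partial>lborel)"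
    by (intro nn_integral_mono mult_right_mono ennreal_leI dens) auto
  also have "\<dots> = ennreal (1 / (2 * \<sigma>)) * ennreal (2 * x)"
    using x by (simp add: nn_integral_cmult_indicator)
  also have "\<dots> = ennreal (x / \<sigma>)" using x \<sigma> by (simp flip: ennreal_mult)
  finally have "measure P {\<omega>\<in>space P. \<bar>D \<omega>\<bar> \<le> x} \<le> x / \<sigma>"
    using x \<sigma> by (simp add: emeasure_eq_measure)
  also have "\<dots> \<le> x / sqrt v" using v\<sigma> x v \<sigma> by (intro divide_left_mono) auto
  finally show ?thesis .
qed

text \<open>The threshold \<open>r ^ n\<close> exceeds the standard deviation, of order
  \<open>sqrt q ^ n\<close>, by a geometric factor. A moment of order \<open>2 * k\<close> turns
  this into the tail bound \<open>((q / r\<^sup>2) ^ k) ^ n\<close>, which is summed over row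
  \<open>n\<close> and fed to Borel--Cantelli.\<close>

lemma AE_gaussian_array_le:
  fixes Z :: "nat \<Rightarrow> 'j \<Rightarrow> 'b \<Rightarrow> real" and q r :: real
  assumes P: "prob_space P" and Z: "\<And>n j. j \<in> J n \<Longrightarrow> centered_normal_rv P (Z n j)"
    and J: "\<And>n. finite (J n)" "\<And>n. real (card (J n)) \<le> T * 2 ^ n"
    and v: "\<And>n j. n \<ge> m \<Longrightarrow> j \<in> J n \<Longrightarrow> (LINT \<omega>|P. (Z n j \<omega>)\<^sup>2) \<le> B * q ^ n"
    and r: "r > 0" "B \<ge> 0" "q \<ge> 0" "q < r\<^sup>2"
  shows "AE \<omega> in P. \<forall>\<^sub>F n in sequentially. \<forall>j\<in>J n. \<bar>Z n j \<omega>\<bar> \<le> r ^ n"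
proof -
  interpret prob_space P by fact
  have [measurable]: "Z n j \<in> borel_measurable P" if "j \<in> J n" for n j
    using Z[OF that] by (simp add: centered_normal_rv_def)
  \<comment> \<open>The union bound costs a factor \<open>2 ^ n\<close>; this \<open>k\<close> keeps
    \<open>2 * (q / r\<^sup>2) ^ k\<close> below 1.\<close>
  obtain k where k: "(q / r\<^sup>2) ^ k < 1 / 2"
    using real_arch_pow_inv[of "1/2" "q / r\<^sup>2"] r by auto
  define C :: real where "C = fact (2 * k) / (2 ^ k * fact k)"
  have C: "C > 0" by (simp add: C_def)
  define A where "A n = (\<Union>j\<in>J n. {\<omega>\<in>space P. r ^ n < \<bar>Z n j \<omega>\<bar>})" for n
  have A[measurable]: "A n \<in> sets P" for n
    unfolding A_def by (intro sets.finite_UN J) measurable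
  have bound: "measure P (A n) \<le> (T * (C * B ^ k)) * (2 * (q / r\<^sup>2) ^ k) ^ n" if "n \<ge> m" for n
  proof -
    have "measure P {\<omega>\<in>space P. r ^ n < \<bar>Z n j \<omega>\<bar>} \<le> C * B ^ k * ((q / r\<^sup>2) ^ k) ^ n" if j: "j \<in> J n" for j
    proof -
      have "measure P {\<omega>\<in>space P. r ^ n < \<bar>Z n j \<omega>\<bar>} \<le> C * (B * q ^ n / (r ^ n)\<^sup>2) ^ k"
        unfolding C_def using r by (intro centered_normal_tail[OF P Z[OF j] v[OF \<open>n \<ge> m\<close> j]]) auto
      also have "B * q ^ n / (r ^ n)\<^sup>2 = B * (q / r\<^sup>2) ^ n"
        by (simp add: power_divide power_mult[symmetric] mult.commute)
      finally show ?thesis by (simp add: power_mult_distrib power_mult[symmetric] mult.commute)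
    qed
    then have "(\<Sum>j\<in>J n. measure P {\<omega>\<in>space P. r ^ n < \<bar>Z n j \<omega>\<bar>}) \<le> real (card (J n)) * (C * B ^ k * ((q / r\<^sup>2) ^ k) ^ n)"
      by (intro sum_bounded_above)
    moreover have "measure P (A n) \<le> (\<Sum>j\<in>J n. measure P {\<omega>\<in>space P. r ^ n < \<bar>Z n j \<omega>\<bar>})"
      unfolding A_def by (rule finite_measure_subadditive_finite) (use J in auto)
    moreover have "real (card (J n)) * (C * B ^ k * ((q / r\<^sup>2) ^ k) ^ n) \<le> (T * 2 ^ n) * (C * B ^ k * ((q / r\<^sup>2) ^ k) ^ n)"
      using C r by (intro mult_right_mono J) auto
    ultimately show ?thesis by (simp add: power_mult_distrib mult_ac)
  qed
  have "summable (\<lambda>n. (T * (C * B ^ k)) * (2 * (q / r\<^sup>2) ^ k) ^ n)"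
    using k r by (intro summable_mult summable_geometric) (auto simp: abs_mult)
  then have "summable (\<lambda>n. measure P (A n))"
    by (rule summable_comparison_test'[of _ m]) (use bound in auto)
  then have "AE \<omega> in P. \<forall>\<^sub>F n in sequentially. \<omega> \<in> space P - A n"
    by (intro borel_cantelli_AE1) (auto simp: less_top[symmetric])
  then show ?thesis
    by eventually_elim (auto simp: A_def not_less elim!: eventually_mono)
qed

subsection \<open>Dyadic chaining\<close>

definition dyadic_floor :: "nat \<Rightarrow> real \<Rightarrow> real" where
  "dyadic_floor n u = real_of_int \<lfloor>2 ^ n * u\<rfloor> / 2 ^ n"

lemma dyadic_floor_le: "dyadic_floor n u \<le> u"
  unfolding dyadic_floor_def by (simp add: divide_le_eq mult.commute)

lemma dyadic_floor_gt: "u - 1 / 2 ^ n < dyadic_floor n u"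
proof -
  have "2 ^ n * u - 1 < real_of_int \<lfloor>2 ^ n * u\<rfloor>" by linarith
  then have "2 ^ n * (u - 1 / 2 ^ n) < 2 ^ n * dyadic_floor n u"
    by (simp add: dyadic_floor_def right_diff_distrib)
  then show ?thesis by simp
qed

lemma dyadic_floor_tendsto: "(\<lambda>n. dyadic_floor n u) \<longlonglongrightarrow> u"
proof (rule tendsto_sandwich)
  show "\<forall>\<^sub>F n in sequentially. u - (1/2) ^ n \<le> dyadic_floor n u"
    using dyadic_floor_gt[of u] by (auto simp: power_divide less_imp_le)
  show "\<forall>\<^sub>F n in sequentially. dyadic_floor n u \<le> u" by (simp add: dyadic_floor_le)
  show "(\<lambda>n. u - (1/2) ^ n) \<longlonglongrightarrow> u"
    by (rule tendsto_eq_intros LIMSEQ_power_zero refl | simp)+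
qed simp

lemma dyadic_floor_nonneg: "u \<ge> 0 \<Longrightarrow> dyadic_floor n u \<ge> 0"
  by (simp add: dyadic_floor_def)

lemma dyadic_floor_eq_nat: "u \<ge> 0 \<Longrightarrow> dyadic_floor n u = real (nat \<lfloor>2 ^ n * u\<rfloor>) / 2 ^ n"
  by (simp add: dyadic_floor_def)

text \<open>Bounding the right endpoint by \<open>\<rho>\<close> confines the condition to points of
  \<open>{0..\<rho>}\<close>, where alone \<open>W\<close> is controlled.\<close>

definition dyadic_steps_le :: "(real \<Rightarrow> real) \<Rightarrow> real \<Rightarrow> nat \<Rightarrow> real \<Rightarrow> bool" where
  "dyadic_steps_le W \<rho> n \<epsilon> \<longleftrightarrow>
     (\<forall>j. real (Suc j) / 2 ^ n \<le> \<rho> \<longrightarrow> \<bar>W (real (Suc j) / 2 ^ n) - W (real j / 2 ^ n)\<bar> \<le> \<epsilon>)"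

lemma dyadic_floor_Suc_diff:
  assumes "dyadic_steps_le W \<rho> (Suc n) \<epsilon>" "0 \<le> u" "u \<le> \<rho>" "\<epsilon> \<ge> 0"
  shows "\<bar>W (dyadic_floor (Suc n) u) - W (dyadic_floor n u)\<bar> \<le> \<epsilon>"
proof -
  define m where "m = nat \<lfloor>2 ^ n * u\<rfloor>"
  have m: "real m \<le> 2 ^ n * u" "2 ^ n * u < real m + 1"
    unfolding m_def using assms by (simp, linarith)
  have n: "dyadic_floor n u = real (2 * m) / 2 ^ Suc n"
    using assms by (simp add: dyadic_floor_eq_nat m_def)
  \<comment> \<open>Refining the grid leaves the floor in place or moves it by one fine step, so
    each level of the chain costs at most one increment.\<close>
  have "\<lfloor>2 ^ Suc n * u\<rfloor> = int (2 * m) \<or> \<lfloor>2 ^ Suc n * u\<rfloor> = int (Suc (2 * m))"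
    using m by (simp add: floor_eq_iff) linarith
  then consider "dyadic_floor (Suc n) u = real (2 * m) / 2 ^ Suc n"
    | "dyadic_floor (Suc n) u = real (Suc (2 * m)) / 2 ^ Suc n"
    by (auto simp: dyadic_floor_def)
  then show ?thesis
  proof cases
    case 1 then show ?thesis using n assms by simp
  next
    case 2
    then have "real (Suc (2 * m)) / 2 ^ Suc n \<le> \<rho>" using dyadic_floor_le[of "Suc n" u] assms by simp
    then show ?thesis using assms(1) 2 n unfolding dyadic_steps_le_def by metis
  qed
qed

text \<open>Two points at distance at most one mesh width have equal or adjacent floors.\<close>

lemma dyadic_floor_near_diff:
  assumes "dyadic_steps_le W \<rho> n \<epsilon>" "0 \<le> u" "u \<le> v" "v \<le> \<rho>" "v - u \<le> 1 / 2 ^ n" "\<epsilon> \<ge> 0"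
  shows "\<bar>W (dyadic_floor n v) - W (dyadic_floor n u)\<bar> \<le> \<epsilon>"
proof -
  define m where "m = nat \<lfloor>2 ^ n * u\<rfloor>"
  have m: "real m \<le> 2 ^ n * u" "2 ^ n * u < real m + 1"
    unfolding m_def using assms by (simp, linarith)
  have n: "dyadic_floor n u = real m / 2 ^ n"
    using assms by (simp add: dyadic_floor_eq_nat m_def)
  have "2 ^ n * u \<le> 2 ^ n * v" using assms by simp
  then have "real m \<le> 2 ^ n * v" using m by linarith
  moreover have "2 ^ n * (v - u) \<le> 1" using assms by (simp add: pos_le_divide_eq mult.commute)
  then have "2 ^ n * v < real m + 2" using m by (simp add: right_diff_distrib)
  ultimately have "\<lfloor>2 ^ n * v\<rfloor> = int m \<or> \<lfloor>2 ^ n * v\<rfloor> = int (Suc m)"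
    using m by (simp add: floor_eq_iff) linarith
  then consider "dyadic_floor n v = real m / 2 ^ n" | "dyadic_floor n v = real (Suc m) / 2 ^ n"
    by (auto simp: dyadic_floor_def)
  then show ?thesis
  proof cases
    case 1 then show ?thesis using n assms by simp
  next
    case 2
    then have "real (Suc m) / 2 ^ n \<le> \<rho>" using dyadic_floor_le[of n v] assms by simp
    then show ?thesis using assms(1) 2 n unfolding dyadic_steps_le_def by metis
  qed
qed

lemma geometric_steps_limit:
  fixes x :: "nat \<Rightarrow> real"
  assumes r: "0 < r" "r < 1" and x: "\<And>n. n \<ge> N \<Longrightarrow> \<bar>x (Suc n) - x n\<bar> \<le> r ^ n"
  shows "convergent x" and "n \<ge> N \<Longrightarrow> \<bar>lim x - x n\<bar> \<le> r ^ n / (1 - r)"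
proof -
  \<comment> \<open>The exact geometric sum is kept because the induction on \<open>k\<close>
    reproduces it; the simpler bound \<open>r ^ n / (1 - r)\<close> would not survive the
    step.\<close>
  have partial: "\<bar>x (n + k) - x n\<bar> \<le> r ^ n * (1 - r ^ k) / (1 - r)" if "n \<ge> N" for n k
  proof (induction k)
    case (Suc k)
    have "\<bar>x (n + Suc k) - x n\<bar> \<le> \<bar>x (Suc (n + k)) - x (n + k)\<bar> + \<bar>x (n + k) - x n\<bar>" by simp
    also have "\<dots> \<le> r ^ (n + k) + r ^ n * (1 - r ^ k) / (1 - r)"
      using x[of "n + k"] Suc that by simp
    also have "\<dots> = r ^ n * (1 - r ^ Suc k) / (1 - r)"
      using r by (simp add: field_simps power_add)
    finally show ?case .
  qed simp
  have tail: "\<bar>x m - x n\<bar> \<le> r ^ n / (1 - r)" if "n \<ge> N" "m \<ge> n" for m n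
  proof -
    have "r ^ n * (1 - r ^ (m - n)) / (1 - r) \<le> r ^ n / (1 - r)"
      using r by (intro divide_right_mono) (auto intro: mult_left_le)
    then show ?thesis using partial[of n "m - n"] that by simp
  qed
  show conv: "convergent x"
  proof (rule Cauchy_convergent, rule CauchyI')
    fix e :: real assume e: "e > 0"
    have "(\<lambda>n. r ^ n / (1 - r)) \<longlonglongrightarrow> 0 / (1 - r)"
      using r by (intro tendsto_intros LIMSEQ_power_zero) auto
    then have "\<forall>\<^sub>F n in sequentially. r ^ n / (1 - r) < e" using e by (intro order_tendstoD) auto
    then obtain n where n: "n \<ge> N" "r ^ n / (1 - r) < e / 1"
      unfolding eventually_sequentially by (metis div_by_1 linear)
    have "r ^ m / (1 - r) < e" if "m \<ge> n" for m
      using power_decreasing[OF that, of r] r n by (smt (verit) div_by_1 divide_right_mono)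
    then show "\<exists>M. \<forall>m\<ge>M. \<forall>n>m. dist (x m) (x n) < e"
      using tail n(1) by (smt (verit, best) dist_real_def le_less order_trans)
  qed
  show "\<bar>lim x - x n\<bar> \<le> r ^ n / (1 - r)" if "n \<ge> N"
  proof (rule tendsto_upperbound)
    show "(\<lambda>m. \<bar>x m - x n\<bar>) \<longlonglongrightarrow> \<bar>lim x - x n\<bar>"
      using conv by (intro tendsto_intros) (simp add: convergent_LIMSEQ_iff)
    show "\<forall>\<^sub>F m in sequentially. \<bar>x m - x n\<bar> \<le> r ^ n / (1 - r)"
      using tail[OF that] by (auto simp: eventually_sequentially)
  qed simp
qed

text \<open>\<open>W\<close> need not be continuous, so the limit along the floors may differ from
  \<open>W u\<close>; as a function of \<open>u\<close> it is the candidate for the continuous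
  version.\<close>

lemma dyadic_limit:
  assumes r: "0 < r" "r < 1"
    and W: "\<And>n. n \<ge> N \<Longrightarrow> dyadic_steps_le W \<rho> n (r ^ n)" and u: "0 \<le> u" "u \<le> \<rho>"
  shows "convergent (\<lambda>n. W (dyadic_floor n u))"
    and "n \<ge> N \<Longrightarrow> \<bar>lim (\<lambda>n. W (dyadic_floor n u)) - W (dyadic_floor n u)\<bar> \<le> r ^ n / (1 - r)"
proof -
  have "\<bar>W (dyadic_floor (Suc n) u) - W (dyadic_floor n u)\<bar> \<le> r ^ n" if "n \<ge> N" for n
  proof -
    have "\<bar>W (dyadic_floor (Suc n) u) - W (dyadic_floor n u)\<bar> \<le> r ^ Suc n"
      using W[of "Suc n"] that r u by (intro dyadic_floor_Suc_diff) auto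
    also have "\<dots> \<le> r ^ n" using r by (intro power_decreasing) auto
    finally show ?thesis .
  qed
  from geometric_steps_limit[OF r, of N "\<lambda>n. W (dyadic_floor n u)", OF this]
  show "convergent (\<lambda>n. W (dyadic_floor n u))"
    "n \<ge> N \<Longrightarrow> \<bar>lim (\<lambda>n. W (dyadic_floor n u)) - W (dyadic_floor n u)\<bar> \<le> r ^ n / (1 - r)" by auto
qed

text \<open>The factor 3 collects the two tails of the chains above level \<open>n\<close> and the
  single step between the floors at level \<open>n\<close>.\<close>

lemma dyadic_limit_near_diff:
  assumes r: "0 < r" "r < 1"
    and W: "\<And>n. n \<ge> N \<Longrightarrow> dyadic_steps_le W \<rho> n (r ^ n)"
    and uv: "0 \<le> u" "u \<le> v" "v \<le> \<rho>" "v - u \<le> 1 / 2 ^ n" "n \<ge> N"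
  shows "\<bar>lim (\<lambda>n. W (dyadic_floor n v)) - lim (\<lambda>n. W (dyadic_floor n u))\<bar> \<le> 3 * r ^ n / (1 - r)"
proof -
  have "\<bar>W (dyadic_floor n v) - W (dyadic_floor n u)\<bar> \<le> r ^ n"
    using W[OF uv(5)] uv r by (intro dyadic_floor_near_diff) auto
  moreover have "r ^ n \<le> r ^ n / (1 - r)" using r by (simp add: field_simps)
  moreover note dyadic_limit(2)[OF r W _ _ uv(5), where u=u] dyadic_limit(2)[OF r W _ _ uv(5), where u=v]
  ultimately show ?thesis using uv by (simp add: field_simps)
qed

lemma dyadic_limit_continuous:
  assumes r: "0 < r" "r < 1"
    and W: "\<And>T. \<exists>N. \<forall>n\<ge>N. dyadic_steps_le W (real T) n (r ^ n)"
  shows "continuous_on {0..} (\<lambda>u. lim (\<lambda>n. W (dyadic_floor n u)))"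
proof (rule continuous_on_iff[THEN iffD2], intro ballI allI impI)
  fix u e :: real assume u: "u \<in> {0..}" and e: "e > 0"
  obtain T :: nat where T: "u + 1 \<le> real T" using real_arch_simple by blast
  obtain N where N: "\<And>n. n \<ge> N \<Longrightarrow> dyadic_steps_le W (real T) n (r ^ n)" using W by blast
  have "(\<lambda>n. 3 * r ^ n / (1 - r)) \<longlonglongrightarrow> 3 * 0 / (1 - r)"
    using r by (intro tendsto_intros LIMSEQ_power_zero) auto
  then have "\<forall>\<^sub>F n in sequentially. 3 * r ^ n / (1 - r) < e" using e by (intro order_tendstoD) auto
  then obtain n where n: "n \<ge> N" "3 * r ^ n / (1 - r) < e"
    unfolding eventually_sequentially by (metis linear)
  show "\<exists>d>0. \<forall>v\<in>{0..}. dist v u < d \<longrightarrow>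
    dist (lim (\<lambda>n. W (dyadic_floor n v))) (lim (\<lambda>n. W (dyadic_floor n u))) < e"
  \<comment> \<open>This radius is at most 1, so \<open>v\<close> stays below \<open>T\<close>,
    which was chosen beyond \<open>u + 1\<close>.\<close>
  proof (intro exI[of _ "1 / 2 ^ n"] conjI ballI impI)
    fix v :: real assume v: "v \<in> {0..}" "dist v u < 1 / 2 ^ n"
    have "1 / 2 ^ n \<le> (1::real)" by simp
    then have T': "u \<le> real T" "v \<le> real T" and d: "\<bar>v - u\<bar> \<le> 1 / 2 ^ n"
      using v T unfolding dist_real_def by linarith+
    have "\<bar>lim (\<lambda>n. W (dyadic_floor n v)) - lim (\<lambda>n. W (dyadic_floor n u))\<bar> \<le> 3 * r ^ n / (1 - r)"
    proof (cases "u \<le> v")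
      case True
      then show ?thesis using u v T' d n(1) by (intro dyadic_limit_near_diff[OF r N]) auto
    next
      case False
      then have "\<bar>lim (\<lambda>n. W (dyadic_floor n u)) - lim (\<lambda>n. W (dyadic_floor n v))\<bar> \<le> 3 * r ^ n / (1 - r)"
        using u v T' d n(1) by (intro dyadic_limit_near_diff[OF r N]) auto
      then show ?thesis by linarith
    qed
    then show "dist (lim (\<lambda>n. W (dyadic_floor n v))) (lim (\<lambda>n. W (dyadic_floor n u))) < e"
      using n by (simp add: dist_real_def)
  qed simp
qed

text \<open>For continuous \<open>W\<close> the limit along the floors is \<open>W\<close> itself,
  so the chaining bound applies to \<open>W\<close>. Comparing \<open>u\<close> with 0 at the level
  where the mesh width matches \<open>u\<close> turns \<open>r ^ n\<close> into a multiple of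
  \<open>u powr \<gamma>\<close>.\<close>

lemma dyadic_hoelder_at_0:
  assumes r: "0 < \<gamma>" "r = 2 powr (- \<gamma>)" and \<rho>: "\<rho> > 0"
    and W: "\<And>n. n \<ge> N \<Longrightarrow> dyadic_steps_le W \<rho> n (r ^ n)" and cont: "continuous_on {0..\<rho>} W"
  obtains C \<delta> where "C > 0" "\<delta> > 0" "\<And>u. 0 \<le> u \<Longrightarrow> u < \<delta> \<Longrightarrow> \<bar>W u - W 0\<bar> \<le> C * u powr \<gamma>"
proof
  have r01: "0 < r" "r < 1" using r(1) powr_less_mono[of "-\<gamma>" 0 2] unfolding r(2) by simp_all
  show "2 powr \<gamma> * 3 / (1 - r) > 0" using r01 by simp
  show "min \<rho> (1 / 2 ^ N) > 0" using \<rho> by simp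
  fix u assume u: "0 \<le> u" "u < min \<rho> (1 / 2 ^ N)"
  show "\<bar>W u - W 0\<bar> \<le> 2 powr \<gamma> * 3 / (1 - r) * u powr \<gamma>"
  proof (cases "u = 0")
    case False
    with u have u0: "u > 0" by simp
    then have "\<exists>n. (1/2) ^ n < u" using real_arch_pow_inv[of u "1/2"] u0 by auto
    \<comment> \<open>With \<open>n = k - 1\<close> this places \<open>u\<close> in the scale
      \<open>(1/2) ^ Suc n < u \<le> (1/2) ^ n\<close>. The upper end admits the chaining bound at
      level \<open>n\<close>; the lower end yields
      \<open>r ^ n \<le> 2 powr \<gamma> * u powr \<gamma>\<close>, the origin of the factor
      \<open>2 powr \<gamma>\<close>.\<close>
    define k where "k = (LEAST k. (1/2) ^ k < u)"
    have k: "(1/2) ^ k < u" "\<And>m. m < k \<Longrightarrow> u \<le> (1/2) ^ m"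
      unfolding k_def using LeastI_ex[OF \<open>\<exists>n. (1/2) ^ n < u\<close>] not_less_Least[of _ "\<lambda>k. (1/2) ^ k < u"]
      by (blast, simp add: not_less)
    have Nk: "N < k"
    proof (rule ccontr)
      assume "\<not> N < k"
      then have "(1/2) ^ N \<le> (1/2 :: real) ^ k" by (intro power_decreasing) auto
      then show False using u k by (simp add: power_divide)
    qed
    define n where "n = k - 1"
    have n: "n \<ge> N" "k = Suc n" using Nk by (auto simp: n_def)
    have lim: "lim (\<lambda>n. W (dyadic_floor n x)) = W x" if "0 \<le> x" "x < \<rho>" for x
    proof (rule limI)
      have c: "continuous (at x within {0..\<rho>}) W" using cont that by (simp add: continuous_on_eq_continuous_within)
      have "dyadic_floor n x \<in> {0..\<rho>}" for n
        using order_trans[OF dyadic_floor_le[of _ x], of \<rho>] dyadic_floor_nonneg[of x] that by auto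
      then show "(\<lambda>n. W (dyadic_floor n x)) \<longlonglongrightarrow> W x"
        by (rule continuous_within_tendsto_compose'[OF c _ dyadic_floor_tendsto])
    qed
    have "\<bar>W u - W 0\<bar> \<le> 3 * r ^ n / (1 - r)"
      using dyadic_limit_near_diff[OF r01 W, where u=0 and v=u and n=n] lim[of u] lim[of 0] k(2)[of n] n u \<rho>
      by (simp add: power_divide)
    also have "r ^ n = 2 powr \<gamma> * ((1/2) ^ k) powr \<gamma>"
    proof -
      have "(1/2 :: real) ^ k = (2 powr - 1) ^ k" by (simp add: powr_minus_divide)
      also have "\<dots> = 2 powr (- real k)" by (subst powr_power) auto
      finally have "2 powr \<gamma> * ((1/2) ^ k) powr \<gamma> = 2 powr (\<gamma> + - real k * \<gamma>)"
        by (simp only: powr_powr powr_add)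
      also have "\<gamma> + - real k * \<gamma> = - \<gamma> * real n" by (simp add: n algebra_simps)
      also have "2 powr (- \<gamma> * real n) = r ^ n" unfolding r(2) by (subst powr_power) (auto simp: mult.commute)
      finally show ?thesis ..
    qed
    also have "3 * (2 powr \<gamma> * ((1/2) ^ k) powr \<gamma>) / (1 - r) \<le> 3 * (2 powr \<gamma> * u powr \<gamma>) / (1 - r)"
      using k r r01 by (intro divide_right_mono mult_left_mono powr_mono2) auto
    finally show ?thesis by (simp add: mult_ac)
  qed simp
qed

subsection \<open>Weakly singular covariance kernels\<close>

lemma has_bochner_integral_abs_powr:
  fixes \<theta> q L :: real
  assumes q: "q > -1" and L: "L \<ge> 0"
  shows "has_bochner_integral lborel (\<lambda>\<sigma>. indicator {\<theta>-L..\<theta>+L} \<sigma> * \<bar>\<theta> - \<sigma>\<bar> powr q) (2 * (L powr (q + 1) / (q + 1)))"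
proof -
  let ?f = "\<lambda>x. indicator {0..L} x * x powr q"
  have hk: "(?f has_integral (L powr (q + 1) / (q + 1))) UNIV"
    using has_integral_powr_from_0[OF q L]
    by (subst (asm) has_integral_restrict_UNIV[symmetric])
       (auto elim!: has_integral_eq[rotated])
  have f: "has_bochner_integral lborel ?f (L powr (q + 1) / (q + 1))"
  proof (rule has_bochner_integral_nn_integral)
    show "(\<integral>\<^sup>+x. ennreal (?f x) \<partial>lborel) = ennreal (L powr (q + 1) / (q + 1))"
      using hk by (intro nn_integral_has_integral_lborel) auto
  qed (use q in auto)
  \<comment> \<open>The symmetric integrand is the sum of two reflected one-sided copies. They
    overlap only at \<open>\<sigma> = \<theta>\<close>, where both vanish by the convention
    \<open>0 powr q = 0\<close>.\<close>
  have "has_bochner_integral lborel (\<lambda>\<sigma>. ?f (-\<theta> + 1 * \<sigma>) + ?f (\<theta> + (-1) * \<sigma>))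
      (L powr (q + 1) / (q + 1) + L powr (q + 1) / (q + 1))"
    using f lborel_has_bochner_integral_real_affine_iff[of 1 ?f "L powr (q + 1) / (q + 1)" "-\<theta>"]
      lborel_has_bochner_integral_real_affine_iff[of "-1" ?f "L powr (q + 1) / (q + 1)" "\<theta>"]
    by (intro has_bochner_integral_add) simp_all
  moreover have "?f (-\<theta> + 1 * \<sigma>) + ?f (\<theta> + (-1) * \<sigma>) = indicator {\<theta>-L..\<theta>+L} \<sigma> * \<bar>\<theta> - \<sigma>\<bar> powr q" for \<sigma>
    using L by (auto simp: indicator_def)
  ultimately show ?thesis by simp
qed

lemma has_bochner_integral_singular_bound:
  fixes \<theta> q L B B' :: real
  assumes q: "q > -1" and L: "L \<ge> 0"
  shows "has_bochner_integral lborel (\<lambda>\<sigma>. indicator {\<theta>-L..\<theta>+L} \<sigma> * (B * \<bar>\<theta> - \<sigma>\<bar> powr q + B'))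
    (B * (2 * (L powr (q + 1) / (q + 1))) + B' * (2 * L))"
proof -
  have "has_bochner_integral lborel (\<lambda>\<sigma>. indicator {\<theta>-L..\<theta>+L} \<sigma> :: real) (2 * L)"
    using L has_bochner_integral_real_indicator[of "{\<theta>-L..\<theta>+L}" lborel] by simp
  then have "has_bochner_integral lborel (\<lambda>\<sigma>. B * (indicator {\<theta>-L..\<theta>+L} \<sigma> * \<bar>\<theta> - \<sigma>\<bar> powr q) + B' * indicator {\<theta>-L..\<theta>+L} \<sigma>)
    (B * (2 * (L powr (q + 1) / (q + 1))) + B' * (2 * L))"
    by (intro has_bochner_integral_add has_bochner_integral_mult_right has_bochner_integral_abs_powr q L)
  then show ?thesis by (simp add: algebra_simps)
qed

text \<open>The bound holds on the whole plane: the power covers the singularity at the diagonal,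
  the constant the region far from it. Together with \<open>q > -1\<close> it makes the integrals
  over bounded sets finite.\<close>

locale singular_kernel =
  fixes K :: "real \<Rightarrow> real \<Rightarrow> real" and B q :: real
  assumes K_meas: "(\<lambda>(\<theta>, \<sigma>). K \<theta> \<sigma>) \<in> borel_measurable (borel \<Otimes>\<^sub>M borel)"
    and K_nonneg: "K \<theta> \<sigma> \<ge> 0"
    and K_bound: "K \<theta> \<sigma> \<le> B * \<bar>\<theta> - \<sigma>\<bar> powr q + B"
    and q: "q > -1"
begin

lemma K_measurable[measurable (raw)]:
  "f \<in> borel_measurable N \<Longrightarrow> g \<in> borel_measurable N \<Longrightarrow> (\<lambda>x. K (f x) (g x)) \<in> borel_measurable N"
  using measurable_compose[OF measurable_Pair, OF _ _ K_meas] by simp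

text \<open>On the diagonal \<open>0 powr q = 0\<close>, so there the bound reads
  \<open>0 \<le> K 0 0 \<le> B\<close>.\<close>

lemma B_nonneg: "B \<ge> 0"
  using K_nonneg[of 0 0] K_bound[of 0 0] by simp

lemma inner_integral:
  assumes A: "A \<in> sets borel" "A \<subseteq> {\<theta>-L..\<theta>+L}" and L: "L \<ge> 0"
  shows "set_integrable lborel A (K \<theta>)"
    and "(LINT \<sigma>:A|lborel. K \<theta> \<sigma>) \<le> B * (2 * (L powr (q + 1) / (q + 1))) + B * (2 * L)"
proof -
  note bd = has_bochner_integral_singular_bound[OF q L, of \<theta> B B]
  have le: "indicator A \<sigma> *\<^sub>R K \<theta> \<sigma> \<le> indicator {\<theta>-L..\<theta>+L} \<sigma> * (B * \<bar>\<theta> - \<sigma>\<bar> powr q + B)" for \<sigma>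
    using A K_bound[of \<theta> \<sigma>] B_nonneg by (auto simp: indicator_def)
  have [measurable]: "A \<in> sets lborel" using A by simp
  show int: "set_integrable lborel A (K \<theta>)"
    unfolding set_integrable_def
  proof (rule Bochner_Integration.integrable_bound[OF integrable.intros[OF bd]])
    have "norm (indicator A \<sigma> *\<^sub>R K \<theta> \<sigma>) = indicator A \<sigma> *\<^sub>R K \<theta> \<sigma>" for \<sigma>
      using K_nonneg by simp
    also note le
    also note abs_ge_self
    finally show "AE \<sigma> in lborel. norm (indicator A \<sigma> *\<^sub>R K \<theta> \<sigma>)
      \<le> norm (indicator {\<theta>-L..\<theta>+L} \<sigma> * (B * \<bar>\<theta> - \<sigma>\<bar> powr q + B))" by simp
  qed simp
  show "(LINT \<sigma>:A|lborel. K \<theta> \<sigma>) \<le> B * (2 * (L powr (q + 1) / (q + 1))) + B * (2 * L)"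
    unfolding has_bochner_integral_integral_eq[OF bd, symmetric] set_lebesgue_integral_def
    using int integrable.intros[OF bd] le by (intro integral_mono) (auto simp: set_integrable_def)
qed

lemma inner_integral_nonneg: "(LINT \<sigma>:A|lborel. K \<theta> \<sigma>) \<ge> 0"
  unfolding set_lebesgue_integral_def by (rule Bochner_Integration.integral_nonneg) (simp add: K_nonneg)

lemma inner_measurable[measurable]:
  assumes [measurable]: "A \<in> sets borel"
  shows "(\<lambda>\<theta>. LINT \<sigma>:A|lborel. K \<theta> \<sigma>) \<in> borel_measurable borel"
  unfolding set_lebesgue_integral_def by measurable

text \<open>For \<open>\<theta>\<close> in \<open>{0..T}\<close> the set \<open>A\<close> lies
  within distance \<open>T\<close> of \<open>\<theta>\<close>, so the inner integral is bounded
  uniformly in \<open>\<theta>\<close>.\<close>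

lemma outer_integrable:
  assumes A: "A \<in> sets borel" "A \<subseteq> {0..T}" and A': "A' \<in> sets borel" "A' \<subseteq> {0..T}" and T: "T \<ge> 0"
  shows "set_integrable lborel A' (\<lambda>\<theta>. LINT \<sigma>:A|lborel. K \<theta> \<sigma>)"
proof -
  define C where "C = B * (2 * (T powr (q + 1) / (q + 1))) + B * (2 * T)"
  have C: "\<bar>LINT \<sigma>:A|lborel. K \<theta> \<sigma>\<bar> \<le> C" if "\<theta> \<in> {0..T}" for \<theta>
  proof -
    have "A \<subseteq> {\<theta>-T..\<theta>+T}" using A that by force
    then show ?thesis
      using inner_integral(2)[OF A(1) _ T, of \<theta>] inner_integral_nonneg[of A \<theta>] by (simp add: C_def)
  qed
  have "set_integrable lborel {0..T} (\<lambda>\<theta>. LINT \<sigma>:A|lborel. K \<theta> \<sigma>)"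
  proof (rule set_integrable_bound[where f="\<lambda>_. C"])
    show "set_integrable lborel {0..T} (\<lambda>_. C)"
      by (simp add: set_integrable_def emeasure_lborel_Icc_eq)
    show "set_borel_measurable lborel {0..T} (\<lambda>\<theta>. LINT \<sigma>:A|lborel. K \<theta> \<sigma>)"
      using A unfolding set_borel_measurable_def by simp
    show "AE \<theta> in lborel. \<theta> \<in> {0..T} \<longrightarrow> norm (LINT \<sigma>:A|lborel. K \<theta> \<sigma>) \<le> norm C"
      using C by fastforce
  qed
  then show ?thesis by (rule set_integrable_subset) (use A' in auto)
qed

definition cov :: "real \<Rightarrow> real \<Rightarrow> real" where
  "cov t s = (LINT \<theta>:{0..t}|lborel. LINT \<sigma>:{0..s}|lborel. K \<theta> \<sigma>)"

text \<open>Inclusion and exclusion for rectangles: the left side is the second moment of an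
  increment of a process with covariance \<open>cov\<close>. The half-open interval makes the
  splitting of \<open>{0..t}\<close> disjoint.\<close>

lemma cov_rectangle:
  assumes st: "0 \<le> s" "s \<le> t"
  shows "cov t t - cov t s - cov s t + cov s s = (LINT \<theta>:{s<..t}|lborel. LINT \<sigma>:{s<..t}|lborel. K \<theta> \<sigma>)"
proof -
  have split: "{0..t} = {0..s} \<union> {s<..t}" "{0..s} \<inter> {s<..t} = {}" using st by auto
  have inner: "(LINT \<sigma>:{0..t}|lborel. K \<theta> \<sigma>) = (LINT \<sigma>:{0..s}|lborel. K \<theta> \<sigma>) + (LINT \<sigma>:{s<..t}|lborel. K \<theta> \<sigma>)" for \<theta>
    unfolding split(1)
    by (rule set_integral_Un) (use st in \<open>auto intro!: inner_integral(1)[of _ _ "\<bar>\<theta>\<bar> + t"]\<close>)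
  have outer: "(LINT \<theta>:{0..t}|lborel. LINT \<sigma>:A|lborel. K \<theta> \<sigma>) = (LINT \<theta>:{0..s}|lborel. LINT \<sigma>:A|lborel. K \<theta> \<sigma>)
     + (LINT \<theta>:{s<..t}|lborel. LINT \<sigma>:A|lborel. K \<theta> \<sigma>)" if "A \<in> sets borel" "A \<subseteq> {0..t}" for A
    unfolding split(1)
    by (rule set_integral_Un) (use that st in \<open>auto intro!: outer_integrable[of A t]\<close>)
  have add: "(LINT \<theta>:A|lborel. LINT \<sigma>:{0..t}|lborel. K \<theta> \<sigma>) =
     (LINT \<theta>:A|lborel. LINT \<sigma>:{0..s}|lborel. K \<theta> \<sigma>) + (LINT \<theta>:A|lborel. LINT \<sigma>:{s<..t}|lborel. K \<theta> \<sigma>)"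
    if "A \<in> sets borel" "A \<subseteq> {0..t}" for A
    unfolding inner by (rule set_integral_add) (use that st in \<open>auto intro!: outer_integrable[of _ t]\<close>)
  show ?thesis
    using outer[of "{0..t}"] outer[of "{0..s}"] add[of "{0..t}"] add[of "{0..s}"] add[of "{s<..t}"] st
    by (simp add: cov_def subset_eq)
qed

text \<open>The inner integral is enlarged to the interval of radius \<open>t - s\<close> centred at
  \<open>\<theta>\<close>, where the power integrates explicitly; the outer one contributes the
  length \<open>t - s\<close>. The local exponent \<open>p\<close> may be better than the global
  \<open>q\<close>.\<close>

lemma rectangle_upper:
  assumes st: "0 \<le> s" "s \<le> t" and p: "p > -1"
    and K: "\<And>\<theta> \<sigma>. \<theta> \<in> {s<..t} \<Longrightarrow> \<sigma> \<in> {s<..t} \<Longrightarrow> K \<theta> \<sigma> \<le> B' * \<bar>\<theta> - \<sigma>\<bar> powr p"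
    and B': "B' \<ge> 0"
  shows "(LINT \<theta>:{s<..t}|lborel. LINT \<sigma>:{s<..t}|lborel. K \<theta> \<sigma>) \<le> 2 * B' / (p + 1) * (t - s) powr (p + 2)"
proof -
  define C where "C = B' * (2 * ((t - s) powr (p + 1) / (p + 1)))"
  have inner: "(LINT \<sigma>:{s<..t}|lborel. K \<theta> \<sigma>) \<le> C" if \<theta>: "\<theta> \<in> {s<..t}" for \<theta>
  proof -
    note bd = has_bochner_integral_mult_right[OF has_bochner_integral_abs_powr[OF p, of "t - s" \<theta>], of B']
    have le: "indicator {s<..t} \<sigma> *\<^sub>R K \<theta> \<sigma> \<le> B' * (indicator {\<theta>-(t-s)..\<theta>+(t-s)} \<sigma> * \<bar>\<theta> - \<sigma>\<bar> powr p)" for \<sigma>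
      using K[OF \<theta>, of \<sigma>] B' \<theta> by (auto simp: indicator_def)
    have "set_integrable lborel {s<..t} (K \<theta>)"
      by (rule inner_integral(1)[of _ _ "t - s"]) (use \<theta> in auto)
    moreover have "has_bochner_integral lborel
      (\<lambda>\<sigma>. B' * (indicator {\<theta>-(t-s)..\<theta>+(t-s)} \<sigma> * \<bar>\<theta> - \<sigma>\<bar> powr p)) C"
      unfolding C_def using bd st by simp
    ultimately have "(LINT \<sigma>:{s<..t}|lborel. K \<theta> \<sigma>) \<le>
      (LINT \<sigma>|lborel. B' * (indicator {\<theta>-(t-s)..\<theta>+(t-s)} \<sigma> * \<bar>\<theta> - \<sigma>\<bar> powr p))"
      unfolding set_lebesgue_integral_def using le
      by (intro integral_mono) (simp_all add: set_integrable_def has_bochner_integral_iff)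
    then show ?thesis
      using bd st by (simp add: C_def has_bochner_integral_iff)
  qed
  have const: "set_integrable lborel {s<..t} (\<lambda>_. C)" using st by (simp add: set_integrable_def)
  have "(LINT \<theta>:{s<..t}|lborel. LINT \<sigma>:{s<..t}|lborel. K \<theta> \<sigma>) \<le> (LINT \<theta>:{s<..t}|lborel. C)"
    by (rule set_integral_mono)
       (use st inner in \<open>auto intro!: outer_integrable[of _ t] const\<close>)
  also have "\<dots> = (t - s) * C" using st by (simp add: set_lebesgue_integral_def)
  also have "\<dots> = 2 * B' / (p + 1) * ((t - s) powr 1 * (t - s) powr (p + 1))" using st by (simp add: C_def)
  also have "(t - s) powr 1 * (t - s) powr (p + 1) = (t - s) powr (p + 2)" by (simp only: powr_add[symmetric]) (simp add: add.commute)
  finally show ?thesis .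
qed

text \<open>Since \<open>p \<le> 0\<close>, the power is smallest at the largest distance, so the
  kernel is at least \<open>c * (t - s) powr p\<close> on a square of area
  \<open>(t - s)\<^sup>2\<close>.\<close>

lemma rectangle_lower:
  assumes st: "0 \<le> s" "s < t" and p: "p \<le> 0"
    and K: "\<And>\<theta> \<sigma>. \<theta> \<in> {s<..t} \<Longrightarrow> \<sigma> \<in> {s<..t} \<Longrightarrow> \<theta> \<noteq> \<sigma> \<Longrightarrow> c * \<bar>\<theta> - \<sigma>\<bar> powr p \<le> K \<theta> \<sigma>"
    and c: "c \<ge> 0"
  shows "c * (t - s) powr (p + 2) \<le> (LINT \<theta>:{s<..t}|lborel. LINT \<sigma>:{s<..t}|lborel. K \<theta> \<sigma>)"
proof -
  define C where "C = c * (t - s) powr p"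
  have inner: "(t - s) * C \<le> (LINT \<sigma>:{s<..t}|lborel. K \<theta> \<sigma>)" if \<theta>: "\<theta> \<in> {s<..t}" for \<theta>
  proof -
    have "(t - s) * C = (LINT \<sigma>:{s<..t}|lborel. C)" using st by (simp add: set_lebesgue_integral_def)
    also have "\<dots> \<le> (LINT \<sigma>:{s<..t}|lborel. K \<theta> \<sigma>)"
    proof (rule set_integral_mono_AE)
      show "set_integrable lborel {s<..t} (\<lambda>_. C)" using st by (simp add: set_integrable_def)
      show "set_integrable lborel {s<..t} (K \<theta>)"
        by (rule inner_integral(1)[of _ _ "t - s"]) (use \<theta> in auto)
      \<comment> \<open>The comparison of powers breaks down at \<open>\<sigma> = \<theta>\<close>,
        where \<open>0 powr p = 0\<close>; this single point is a null set.\<close>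
      show "AE \<sigma>\<in>{s<..t} in lborel. C \<le> K \<theta> \<sigma>"
        using AE_lborel_singleton[of \<theta>]
      proof eventually_elim
        case (elim \<sigma>)
        show ?case
        proof
          assume \<sigma>: "\<sigma> \<in> {s<..t}"
          have "(t - s) powr p \<le> \<bar>\<theta> - \<sigma>\<bar> powr p"
            using elim \<sigma> \<theta> p by (intro powr_mono2') auto
          then show "C \<le> K \<theta> \<sigma>"
            using K[OF \<theta> \<sigma>] elim c mult_left_mono[of "(t - s) powr p" "\<bar>\<theta> - \<sigma>\<bar> powr p" c] by (auto simp: C_def)
        qed
      qed
    qed
    finally show ?thesis .
  qed
  have const: "set_integrable lborel {s<..t} (\<lambda>_. (t - s) * C)" using st by (simp add: set_integrable_def)
  have "c * (t - s) powr (p + 2) = (t - s) * ((t - s) * C)"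
    using st by (simp add: C_def powr_add power2_eq_square powr_numeral)
  also have "\<dots> = (LINT \<theta>:{s<..t}|lborel. (t - s) * C)" using st by (simp add: set_lebesgue_integral_def)
  also have "\<dots> \<le> (LINT \<theta>:{s<..t}|lborel. LINT \<sigma>:{s<..t}|lborel. K \<theta> \<sigma>)"
    by (rule set_integral_mono[OF const])
       (use st inner in \<open>auto intro!: outer_integrable[of _ t]\<close>)
  finally show ?thesis .
qed

end

subsection \<open>Regularity of Gaussian processes\<close>

lemma centered_gaussian_processD:
  "centered_gaussian_process P I S \<Longrightarrow> finite F \<Longrightarrow> F \<subseteq> I \<Longrightarrow> centered_normal_rv P (\<lambda>\<omega>. \<Sum>i\<in>F. c i * S i \<omega>)"
  by (simp add: centered_gaussian_process_def)

lemma gaussian_process_diff_normal: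
  assumes "centered_gaussian_process P I S" "s \<in> I" "t \<in> I"
  shows "centered_normal_rv P (\<lambda>\<omega>. S t \<omega> - S s \<omega>)"
proof (cases "s = t")
  \<comment> \<open>For \<open>s = t\<close> the index set \<open>{s, t}\<close> would collapse to
    one point and lose the cancellation; the empty combination supplies the zero variable
    instead.\<close>
  case True
  have "centered_normal_rv P (\<lambda>\<omega>. \<Sum>i\<in>{}. (0::real) * S i \<omega>)"
    by (rule centered_gaussian_processD[OF assms(1)]) auto
  then show ?thesis using True by simp
next
  case False
  have "centered_normal_rv P (\<lambda>\<omega>. \<Sum>i\<in>{s, t}. (if i = t then 1 else -1) * S i \<omega>)"
    using assms by (intro centered_gaussian_processD[of P I]) auto
  then show ?thesis using False by simp
qed

lemma gaussian_process_normal: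
  assumes "centered_gaussian_process P I S" "t \<in> I"
  shows "centered_normal_rv P (S t)"
proof -
  have "centered_normal_rv P (\<lambda>\<omega>. \<Sum>i\<in>{t}. 1 * S i \<omega>)"
    using assms by (intro centered_gaussian_processD[of P I]) auto
  then show ?thesis by simp
qed

lemma AE_dyadic_steps_le:
  assumes P: "prob_space P"
    and normal: "\<And>u v. u \<in> {0..\<rho>} \<Longrightarrow> v \<in> {0..\<rho>} \<Longrightarrow> centered_normal_rv P (\<lambda>\<omega>. W u \<omega> - W v \<omega>)"
    and var: "\<And>u v. u \<in> {0..\<rho>} \<Longrightarrow> v \<in> {0..\<rho>} \<Longrightarrow> \<bar>u - v\<bar> \<le> 1 \<Longrightarrow>
      (LINT \<omega>|P. (W u \<omega> - W v \<omega>)\<^sup>2) \<le> B * \<bar>u - v\<bar> powr (2 * H)"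
    and B: "B \<ge> 0" and \<gamma>: "0 < \<gamma>" "\<gamma> < H"
  shows "AE \<omega> in P. \<forall>\<^sub>F n in sequentially. dyadic_steps_le (\<lambda>u. W u \<omega>) \<rho> n ((2 powr - \<gamma>) ^ n)"
proof -
  define J where "J n = {j. real (Suc j) / 2 ^ n \<le> \<rho>}" for n
  obtain T :: nat where T: "\<rho> \<le> real T" using real_arch_simple by blast
  have J: "J n \<subseteq> {..<T * 2 ^ n}" for n
  proof
    fix j assume "j \<in> J n"
    then have "real (Suc j) \<le> \<rho> * 2 ^ n" by (simp add: J_def pos_divide_le_eq)
    also have "\<dots> \<le> real T * 2 ^ n" using T by simp
    also have "\<dots> = real (T * 2 ^ n)" by simp
    finally have "Suc j \<le> T * 2 ^ n" by (simp only: of_nat_le_iff)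
    then show "j \<in> {..<T * 2 ^ n}" by simp
  qed
  then have fin: "finite (J n)" for n using finite_subset by blast
  have card: "real (card (J n)) \<le> real T * 2 ^ n" for n
    using card_mono[OF _ J[of n]] of_nat_mono[of "card (J n)" "T * 2 ^ n"] by simp
  have in_range: "real (Suc j) / 2 ^ n \<in> {0..\<rho>}" "real j / 2 ^ n \<in> {0..\<rho>}" if "j \<in> J n" for n j
  proof -
    have "real j / 2 ^ n \<le> real (Suc j) / 2 ^ n" by (intro divide_right_mono) auto
    then show "real (Suc j) / 2 ^ n \<in> {0..\<rho>}" "real j / 2 ^ n \<in> {0..\<rho>}" using that by (auto simp: J_def)
  qed
  define Z where "Z n j \<omega> = W (real (Suc j) / 2 ^ n) \<omega> - W (real j / 2 ^ n) \<omega>" for n j \<omega>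
  have "AE \<omega> in P. \<forall>\<^sub>F n in sequentially. \<forall>j\<in>J n. \<bar>Z n j \<omega>\<bar> \<le> (2 powr - \<gamma>) ^ n"
  proof (rule AE_gaussian_array_le[OF P _ fin card, where m=0 and B=B and q="2 powr (- 2 * H)"])
    fix n j assume j: "j \<in> J n"
    show "centered_normal_rv P (Z n j)" unfolding Z_def by (intro normal in_range j)
    have step: "real (Suc j) / 2 ^ n - real j / 2 ^ n = 1 / 2 ^ n" by (simp add: field_simps)
    have "(LINT \<omega>|P. (Z n j \<omega>)\<^sup>2) \<le> B * \<bar>1 / 2 ^ n\<bar> powr (2 * H)"
      unfolding Z_def using var[OF in_range(1)[OF j] in_range(2)[OF j]] unfolding step by simp
    also have "\<bar>1 / 2 ^ n\<bar> powr (2 * H) = (2 powr (- 2 * H)) ^ n"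
      by (simp add: powr_power powr_minus_divide powr_powr powr_divide mult_ac flip: powr_realpow)
    finally show "(LINT \<omega>|P. (Z n j \<omega>)\<^sup>2) \<le> B * (2 powr (- 2 * H)) ^ n" .
  next
    \<comment> \<open>This is where \<open>\<gamma> < H\<close> is used: variances decay at rate
      \<open>2 powr (- 2 * H)\<close>, squared thresholds at rate
      \<open>2 powr (- 2 * \<gamma>)\<close>.\<close>
    show "2 powr (- 2 * H) < (2 powr - \<gamma> :: real)\<^sup>2" using \<gamma> by (simp add: powr_power)
  qed (use B in auto)
  then show ?thesis
    by eventually_elim (auto elim!: eventually_mono simp: dyadic_steps_le_def J_def Z_def)
qed

lemma gaussian_continuous_modification:
  assumes P: "prob_space P" and S: "centered_gaussian_process P {0..} S"
    and var: "\<And>u v. u \<ge> 0 \<Longrightarrow> v \<ge> 0 \<Longrightarrow> \<bar>u - v\<bar> \<le> 1 \<Longrightarrow>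
      (LINT \<omega>|P. (S u \<omega> - S v \<omega>)\<^sup>2) \<le> B * \<bar>u - v\<bar> powr (2 * H)"
    and B: "B \<ge> 0" and H: "0 < H"
  shows "\<exists>Y. continuous_modification P S Y"
proof -
  \<comment> \<open>The exponent \<open>H / 2\<close> is an arbitrary choice strictly between 0 and
    \<open>H\<close>; only continuity is sought here.\<close>
  define r :: real where "r = 2 powr - (H / 2)"
  have r: "0 < r" "r < 1" using H powr_less_mono[of "- (H / 2)" 0 2] unfolding r_def by simp_all
  have normal: "centered_normal_rv P (\<lambda>\<omega>. S u \<omega> - S v \<omega>)" if "u \<ge> 0" "v \<ge> 0" for u v
    using gaussian_process_diff_normal[OF S] that by simp
  have S_meas: "S t \<in> borel_measurable P" if "t \<ge> 0" for t
    using gaussian_process_normal[OF S, of t] that by (simp add: centered_normal_rv_def)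
  have S_dyadic[measurable]: "S (real j / 2 ^ n) \<in> borel_measurable P" for j n by (simp add: S_meas)
  \<comment> \<open>The good paths are described by quantifiers over natural numbers only, which
    makes the set measurable.\<close>
  define G where "G = {\<omega>\<in>space P. \<forall>T. \<exists>N. \<forall>n\<ge>N. \<forall>j. real (Suc j) / 2 ^ n \<le> real (T::nat) \<longrightarrow>
    \<bar>S (real (Suc j) / 2 ^ n) \<omega> - S (real j / 2 ^ n) \<omega>\<bar> \<le> r ^ n}"
  have G_meas[measurable]: "G \<in> sets P" unfolding G_def by measurable
  have AE_G: "AE \<omega> in P. \<omega> \<in> G"
  proof -
    have "AE \<omega> in P. \<forall>\<^sub>F n in sequentially. dyadic_steps_le (\<lambda>u. S u \<omega>) (real T) n (r ^ n)" for T
      unfolding r_def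
      by (rule AE_dyadic_steps_le[OF P, where B=B and H=H]) (use normal var B H in auto)
    then have "AE \<omega> in P. \<forall>T. \<forall>\<^sub>F n in sequentially. dyadic_steps_le (\<lambda>u. S u \<omega>) (real T) n (r ^ n)"
      by (simp add: AE_all_countable)
    then show ?thesis using AE_space
      by eventually_elim (auto simp: G_def eventually_sequentially dyadic_steps_le_def)
  qed
  \<comment> \<open>A modification must have continuous paths at every \<open>\<omega>\<close>; the
    value 0 secures this off \<open>G\<close>.\<close>
  define Y where "Y t \<omega> = (if \<omega> \<in> G then lim (\<lambda>n. S (dyadic_floor n t) \<omega>) else 0)" for t \<omega>
  have "continuous_modification P S Y"
    unfolding continuous_modification_def
  proof (intro conjI allI impI ballI)
    fix t :: real assume t: "t \<ge> 0"
    have [measurable]: "S (dyadic_floor n t) \<in> borel_measurable P" for n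
      using t by (intro S_meas dyadic_floor_nonneg)
    have [measurable]: "(\<lambda>\<omega>. lim (\<lambda>n. S (dyadic_floor n t) \<omega>)) \<in> borel_measurable P"
      by (rule borel_measurable_lim_metric) measurable
    show "Y t \<in> borel_measurable P" unfolding Y_def by measurable
    \<comment> \<open>To identify the limit with \<open>S t\<close> at a fixed, possibly non-dyadic
      \<open>t\<close>, the array estimate is applied to rows of one entry.\<close>
    have "AE \<omega> in P. \<forall>\<^sub>F n in sequentially. \<forall>j\<in>{()}. \<bar>S t \<omega> - S (dyadic_floor n t) \<omega>\<bar> \<le> r ^ n"
    proof (rule AE_gaussian_array_le[OF P, where T=1 and m=0 and B=B and q="2 powr (- 2 * H)"])
      fix n :: nat
      show "centered_normal_rv P (\<lambda>\<omega>. S t \<omega> - S (dyadic_floor n t) \<omega>)"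
        using t by (intro normal dyadic_floor_nonneg)
      have d: "\<bar>t - dyadic_floor n t\<bar> \<le> 1 / 2 ^ n"
        using dyadic_floor_gt[of t n] dyadic_floor_le[of n t] by simp
      moreover have "1 / 2 ^ n \<le> (1::real)" by simp
      ultimately have "\<bar>t - dyadic_floor n t\<bar> \<le> 1" by linarith
      then have "(LINT \<omega>|P. (S t \<omega> - S (dyadic_floor n t) \<omega>)\<^sup>2) \<le> B * \<bar>t - dyadic_floor n t\<bar> powr (2 * H)"
        using t by (intro var dyadic_floor_nonneg)
      also have "\<dots> \<le> B * (1 / 2 ^ n) powr (2 * H)"
        using d B H by (intro mult_left_mono powr_mono2) auto
      also have "(1 / 2 ^ n) powr (2 * H) = (2 powr (- 2 * H)) ^ n"
        by (simp add: powr_power powr_minus_divide powr_powr powr_divide mult_ac flip: powr_realpow)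
      finally show "(LINT \<omega>|P. (S t \<omega> - S (dyadic_floor n t) \<omega>)\<^sup>2) \<le> B * (2 powr (- 2 * H)) ^ n" .
    next
      show "2 powr (- 2 * H) < r\<^sup>2" using H by (simp add: r_def powr_power)
    qed (use B r in auto)
    then show "AE \<omega> in P. Y t \<omega> = S t \<omega>" using AE_G
    proof eventually_elim
      case (elim \<omega>)
      have "(\<lambda>n. r ^ n) \<longlonglongrightarrow> 0" using r by (intro LIMSEQ_power_zero) auto
      moreover have "\<forall>\<^sub>F n in sequentially. norm (S (dyadic_floor n t) \<omega> - S t \<omega>) \<le> r ^ n"
        using elim(1) by eventually_elim (simp add: abs_minus_commute)
      ultimately have "(\<lambda>n. S (dyadic_floor n t) \<omega> - S t \<omega>) \<longlonglongrightarrow> 0"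
        by (rule Lim_null_comparison[rotated])
      then have "(\<lambda>n. S (dyadic_floor n t) \<omega>) \<longlonglongrightarrow> S t \<omega>" by (simp add: LIM_zero_iff)
      then show ?case using elim(2) by (simp add: Y_def limI)
    qed
  next
    fix \<omega> assume "\<omega> \<in> space P"
    show "continuous_on {0..} (\<lambda>t. Y t \<omega>)"
    proof (cases "\<omega> \<in> G")
      case True
      then have "continuous_on {0..} (\<lambda>t. lim (\<lambda>n. S (dyadic_floor n t) \<omega>))"
        by (intro dyadic_limit_continuous[OF r, of "\<lambda>t. S t \<omega>"]) (auto simp: G_def dyadic_steps_le_def)
      then show ?thesis using True by (simp add: Y_def)
    qed (simp add: Y_def)
  qed
  then show ?thesis by blast
qed

text \<open>\<open>W\<close> carries the Gaussian estimates and \<open>V\<close> the continuity.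
  They agree almost surely at all dyadic points of \<open>{0..\<rho>}\<close> at once, and the step
  bounds involve no other values.\<close>

lemma AE_gaussian_hoelder_at_0:
  assumes P: "prob_space P"
    and normal: "\<And>u v. u \<in> {0..\<rho>} \<Longrightarrow> v \<in> {0..\<rho>} \<Longrightarrow> centered_normal_rv P (\<lambda>\<omega>. W u \<omega> - W v \<omega>)"
    and var: "\<And>u v. u \<in> {0..\<rho>} \<Longrightarrow> v \<in> {0..\<rho>} \<Longrightarrow> \<bar>u - v\<bar> \<le> 1 \<Longrightarrow>
      (LINT \<omega>|P. (W u \<omega> - W v \<omega>)\<^sup>2) \<le> B * \<bar>u - v\<bar> powr (2 * H)"
    and B: "B \<ge> 0" and \<gamma>: "0 < \<gamma>" "\<gamma> < H" and \<rho>: "\<rho> > 0"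
    and V: "\<And>u. u \<in> {0..\<rho>} \<Longrightarrow> AE \<omega> in P. V u \<omega> = W u \<omega>"
    and cont: "\<And>\<omega>. \<omega> \<in> space P \<Longrightarrow> continuous_on {0..\<rho>} (\<lambda>u. V u \<omega>)"
  shows "AE \<omega> in P. \<exists>C>0. \<exists>\<delta>>0. \<forall>u\<ge>0. u < \<delta> \<longrightarrow> \<bar>V u \<omega> - V 0 \<omega>\<bar> \<le> C * u powr \<gamma>"
proof -
  have "AE \<omega> in P. real j / 2 ^ n \<le> \<rho> \<longrightarrow> V (real j / 2 ^ n) \<omega> = W (real j / 2 ^ n) \<omega>" for j n
    using V[of "real j / 2 ^ n"] by (cases "real j / 2 ^ n \<le> \<rho>") simp_all
  then have "AE \<omega> in P. \<forall>n j. real j / 2 ^ n \<le> \<rho> \<longrightarrow> V (real j / 2 ^ n) \<omega> = W (real j / 2 ^ n) \<omega>"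
    by (simp add: AE_all_countable)
  moreover have "AE \<omega> in P. \<forall>\<^sub>F n in sequentially. dyadic_steps_le (\<lambda>u. W u \<omega>) \<rho> n ((2 powr - \<gamma>) ^ n)"
    by (rule AE_dyadic_steps_le[OF P _ _ B \<gamma>]) (use normal var in auto)
  ultimately show ?thesis using AE_space
  proof eventually_elim
    case (elim \<omega>)
    have "dyadic_steps_le (\<lambda>u. V u \<omega>) \<rho> n \<epsilon>" if "dyadic_steps_le (\<lambda>u. W u \<omega>) \<rho> n \<epsilon>" for n \<epsilon>
    proof -
      have "real j / 2 ^ n \<le> \<rho>" if "real (Suc j) / 2 ^ n \<le> \<rho>" for j
        by (rule order_trans[OF _ that]) (intro divide_right_mono, auto)
      then show ?thesis using that elim(1) by (auto simp: dyadic_steps_le_def simp del: of_nat_Suc)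
    qed
    with elim(2) obtain N where "\<And>n. n \<ge> N \<Longrightarrow> dyadic_steps_le (\<lambda>u. V u \<omega>) \<rho> n ((2 powr - \<gamma>) ^ n)"
      unfolding eventually_sequentially by blast
    from dyadic_hoelder_at_0[OF \<gamma>(1) refl \<rho> this cont[OF elim(3)]] show ?case by metis
  qed
qed

lemma AE_gaussian_hoelder_at:
  assumes P: "prob_space P" and S: "centered_gaussian_process P {0..} S"
    and Y: "continuous_modification P S Y" and t0: "t0 \<ge> 0" and \<delta>: "\<delta> > 0"
    and var: "\<And>u v. u \<ge> 0 \<Longrightarrow> v \<ge> 0 \<Longrightarrow> \<bar>u - t0\<bar> \<le> \<delta> \<Longrightarrow> \<bar>v - t0\<bar> \<le> \<delta> \<Longrightarrow> \<bar>u - v\<bar> \<le> 1 \<Longrightarrow>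
      (LINT \<omega>|P. (S u \<omega> - S v \<omega>)\<^sup>2) \<le> B * \<bar>u - v\<bar> powr (2 * H)"
    and B: "B \<ge> 0" and \<gamma>: "0 < \<gamma>" "\<gamma> < H"
  shows "AE \<omega> in P. \<exists>C>0. \<exists>\<delta>>0. \<forall>t\<ge>0. \<bar>t - t0\<bar> < \<delta> \<longrightarrow> \<bar>Y t \<omega> - Y t0 \<omega>\<bar> \<le> C * \<bar>t - t0\<bar> powr \<gamma>"
proof -
  \<comment> \<open>The sign \<open>e\<close> selects the side of \<open>t0\<close>; on the left,
    \<open>\<rho> \<le> t0\<close> keeps all times nonnegative.\<close>
  have side: "AE \<omega> in P. \<exists>C>0. \<exists>\<delta>>0. \<forall>u\<ge>0. u < \<delta> \<longrightarrow> \<bar>Y (t0 + e * u) \<omega> - Y (t0 + e * 0) \<omega>\<bar> \<le> C * u powr \<gamma>"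
    if e: "\<bar>e\<bar> = 1" and \<rho>: "\<rho> > 0" "\<rho> \<le> \<delta>" "e = - 1 \<Longrightarrow> \<rho> \<le> t0" for e \<rho> :: real
  proof -
    have e': "e = 1 \<or> e = - 1" using e by linarith
    have nonneg: "t0 + e * u \<ge> 0" "\<bar>t0 + e * u - t0\<bar> \<le> \<delta>" if "u \<in> {0..\<rho>}" for u
      using e' that \<rho> t0 by auto
    have diff: "\<bar>t0 + e * u - (t0 + e * v)\<bar> = \<bar>u - v\<bar>" for u v using e' by auto
    show ?thesis
    proof (rule AE_gaussian_hoelder_at_0[OF P _ _ B \<gamma> \<rho>(1), where W="\<lambda>u. S (t0 + e * u)"])
      fix u v assume uv: "u \<in> {0..\<rho>}" "v \<in> {0..\<rho>}"
      show "centered_normal_rv P (\<lambda>\<omega>. S (t0 + e * u) \<omega> - S (t0 + e * v) \<omega>)"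
        by (rule gaussian_process_diff_normal[OF S]) (use nonneg uv in auto)
      show "(LINT \<omega>|P. (S (t0 + e * u) \<omega> - S (t0 + e * v) \<omega>)\<^sup>2) \<le> B * \<bar>u - v\<bar> powr (2 * H)" if "\<bar>u - v\<bar> \<le> 1"
        using var[OF nonneg(1)[OF uv(1)] nonneg(1)[OF uv(2)] nonneg(2)[OF uv(1)] nonneg(2)[OF uv(2)]] that
        by (simp only: diff)
    next
      fix u assume "u \<in> {0..\<rho>}"
      then show "AE \<omega> in P. Y (t0 + e * u) \<omega> = S (t0 + e * u) \<omega>"
        using Y nonneg(1) by (simp add: continuous_modification_def)
    next
      fix \<omega> assume "\<omega> \<in> space P"
      then have "continuous_on {0..} (\<lambda>t. Y t \<omega>)" using Y by (simp add: continuous_modification_def)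
      then show "continuous_on {0..\<rho>} (\<lambda>u. Y (t0 + e * u) \<omega>)"
        by (rule continuous_on_compose2) (use nonneg in \<open>auto intro!: continuous_intros\<close>)
    qed
  qed
  have right: "AE \<omega> in P. \<exists>C>0. \<exists>\<delta>>0. \<forall>u\<ge>0. u < \<delta> \<longrightarrow> \<bar>Y (t0 + u) \<omega> - Y t0 \<omega>\<bar> \<le> C * u powr \<gamma>"
    using side[of 1 \<delta>] \<delta> by simp
  \<comment> \<open>The premise \<open>u \<le> t0\<close> lets the statement include
    \<open>t0 = 0\<close>, where only \<open>u = 0\<close> remains.\<close>
  have left: "AE \<omega> in P. \<exists>C>0. \<exists>\<delta>>0. \<forall>u\<ge>0. u < \<delta> \<longrightarrow> u \<le> t0 \<longrightarrow> \<bar>Y (t0 - u) \<omega> - Y t0 \<omega>\<bar> \<le> C * u powr \<gamma>"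
  proof (cases "t0 = 0")
    case True
    then show ?thesis by (intro AE_I2) (auto intro!: exI[of _ 1])
  next
    case False
    then have "AE \<omega> in P. \<exists>C>0. \<exists>\<delta>>0. \<forall>u\<ge>0. u < \<delta> \<longrightarrow> \<bar>Y (t0 - u) \<omega> - Y t0 \<omega>\<bar> \<le> C * u powr \<gamma>"
      using side[of "- 1" "min \<delta> t0"] \<delta> t0 by simp
    then show ?thesis by eventually_elim blast
  qed
  from right left show ?thesis
  proof eventually_elim
    case (elim \<omega>)
    then obtain C1 \<delta>1 C2 \<delta>2 where 1: "C1 > 0" "\<delta>1 > 0" "C2 > 0" "\<delta>2 > 0"
      and r: "\<And>u. u \<ge> 0 \<Longrightarrow> u < \<delta>1 \<Longrightarrow> \<bar>Y (t0 + u) \<omega> - Y t0 \<omega>\<bar> \<le> C1 * u powr \<gamma>"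
      and l: "\<And>u. u \<ge> 0 \<Longrightarrow> u < \<delta>2 \<Longrightarrow> u \<le> t0 \<Longrightarrow> \<bar>Y (t0 - u) \<omega> - Y t0 \<omega>\<bar> \<le> C2 * u powr \<gamma>"
      by blast
    have "\<bar>Y t \<omega> - Y t0 \<omega>\<bar> \<le> max C1 C2 * \<bar>t - t0\<bar> powr \<gamma>" if "t \<ge> 0" "\<bar>t - t0\<bar> < min \<delta>1 \<delta>2" for t
    proof (cases "t \<ge> t0")
      case True
      then have "\<bar>Y t \<omega> - Y t0 \<omega>\<bar> \<le> C1 * \<bar>t - t0\<bar> powr \<gamma>" using r[of "t - t0"] that by simp
      also have "\<dots> \<le> max C1 C2 * \<bar>t - t0\<bar> powr \<gamma>" by (intro mult_right_mono) auto
      finally show ?thesis .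
    next
      case False
      then have "\<bar>Y t \<omega> - Y t0 \<omega>\<bar> \<le> C2 * \<bar>t - t0\<bar> powr \<gamma>" using l[of "t0 - t"] that by (simp add: abs_minus_commute)
      also have "\<dots> \<le> max C1 C2 * \<bar>t - t0\<bar> powr \<gamma>" by (intro mult_right_mono) auto
      finally show ?thesis .
    qed
    then show ?case using 1 by (intro exI[of _ "max C1 C2"] exI[of _ "min \<delta>1 \<delta>2"] conjI) auto
  qed
qed

text \<open>The increment over \<open>(1/2) ^ n\<close> has standard deviation at least
  \<open>sqrt c * ((1/2) ^ n) powr H\<close>, so it falls below the threshold with probability at
  most \<open>y n\<close>, which tends to 0. Holding for all \<open>n \<ge> N\<close> implies each
  single event, hence has probability 0; no independence enters. Times to the right of
  \<open>t0\<close> also serve \<open>t0 = 0\<close>.\<close>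

lemma AE_gaussian_irregular_at:
  assumes P: "prob_space P" and S: "centered_gaussian_process P {0..} S"
    and t0: "t0 \<ge> 0" and \<delta>: "\<delta> > 0" and c: "c > 0"
    and var: "\<And>t. t0 < t \<Longrightarrow> t \<le> t0 + \<delta> \<Longrightarrow> c * (t - t0) powr (2 * H) \<le> (LINT \<omega>|P. (S t \<omega> - S t0 \<omega>)\<^sup>2)"
    and \<alpha>: "H < \<alpha>"
  shows "AE \<omega> in P. \<not> (\<forall>\<^sub>F n in sequentially. \<bar>S (t0 + (1/2) ^ n) \<omega> - S t0 \<omega>\<bar> \<le> ((1/2) ^ n) powr \<alpha>)"
proof -
  interpret prob_space P by fact
  define D where "D n \<omega> = S (t0 + (1/2) ^ n) \<omega> - S t0 \<omega>" for n \<omega>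
  have normal: "centered_normal_rv P (D n)" for n
    unfolding D_def by (rule gaussian_process_diff_normal[OF S]) (use t0 in auto)
  then have [measurable]: "D n \<in> borel_measurable P" for n by (simp add: centered_normal_rv_def)
  obtain m where m: "(1/2) ^ m < \<delta>" using real_arch_pow_inv[of \<delta> "1/2"] \<delta> by auto
  define y where "y n = ((1/2) powr (\<alpha> - H)) ^ n / sqrt c" for n
  have small: "prob {\<omega>\<in>space P. \<bar>D n \<omega>\<bar> \<le> ((1/2) ^ n) powr \<alpha>} \<le> y n" if "n \<ge> m" for n
  proof -
    have "(1/2) ^ n \<le> (1/2 :: real) ^ m" using that by (intro power_decreasing) auto
    then have "(1/2) ^ n \<le> \<delta>" using m by linarith
    then have "c * ((1/2) ^ n) powr (2 * H) \<le> (LINT \<omega>|P. (D n \<omega>)\<^sup>2)"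
      unfolding D_def using var[of "t0 + (1/2) ^ n"] by simp
    then have "prob {\<omega>\<in>space P. \<bar>D n \<omega>\<bar> \<le> ((1/2) ^ n) powr \<alpha>} \<le> ((1/2) ^ n) powr \<alpha> / sqrt (c * ((1/2) ^ n) powr (2 * H))"
      using c by (intro centered_normal_small_ball[OF P normal]) auto
    also have "sqrt (((1/2) ^ n) powr (2 * H)) = ((1/2 :: real) ^ n) powr H"
      by (rule real_sqrt_unique) (auto simp: powr_power)
    then have "((1/2) ^ n) powr \<alpha> / sqrt (c * ((1/2) ^ n) powr (2 * H)) = ((1/2) ^ n) powr (\<alpha> - H) / sqrt c"
      by (simp add: real_sqrt_mult powr_diff)
    also have "\<dots> = y n" by (simp add: y_def powr_power powr_powr mult.commute flip: powr_realpow)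
    finally show ?thesis .
  qed
  have "(1/2) powr (\<alpha> - H) < (1/2 :: real) powr 0" using \<alpha> by (intro powr_less_mono') auto
  then have "y \<longlonglongrightarrow> 0 / sqrt c" unfolding y_def using c by (intro tendsto_intros LIMSEQ_power_zero) auto
  then have y: "y \<longlonglongrightarrow> 0" by simp
  have "AE \<omega> in P. \<omega> \<notin> {\<omega>\<in>space P. \<forall>n\<ge>N. \<bar>D n \<omega>\<bar> \<le> ((1/2) ^ n) powr \<alpha>}" for N
  proof -
    let ?A = "{\<omega>\<in>space P. \<forall>n\<ge>N. \<bar>D n \<omega>\<bar> \<le> ((1/2) ^ n) powr \<alpha>}"
    have A: "?A \<in> events" by measurable
    have "prob ?A \<le> y n" if "n \<ge> max m N" for n
    proof -
      have "prob ?A \<le> prob {\<omega>\<in>space P. \<bar>D n \<omega>\<bar> \<le> ((1/2) ^ n) powr \<alpha>}"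
        using that by (intro finite_measure_mono) auto
      also have "\<dots> \<le> y n" using small that by simp
      finally show ?thesis .
    qed
    then have "prob ?A \<le> 0" by (intro LIMSEQ_le_const[OF y]) blast
    then have "prob ?A = 0" using measure_nonneg[of P ?A] by linarith
    then show ?thesis using prob_eq_0[OF A] by simp
  qed
  then have "AE \<omega> in P. \<forall>N. \<omega> \<notin> {\<omega>\<in>space P. \<forall>n\<ge>N. \<bar>D n \<omega>\<bar> \<le> ((1/2) ^ n) powr \<alpha>}"
    unfolding AE_all_countable by (rule allI)
  then show ?thesis using AE_space
    by eventually_elim (auto simp: eventually_sequentially D_def)
qed

text \<open>An order \<open>\<beta>\<close> below some \<open>\<gamma> k\<close> leaves a positive
  power of the distance, which tends to 0. An order above some \<open>\<alpha> k\<close> would force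
  the forbidden inequality along \<open>t0 + (1/2) ^ n\<close>.\<close>

lemma pointwise_hoelder_exponent_eqI:
  fixes f :: "real \<Rightarrow> real"
  assumes t0: "t0 \<ge> 0" and h0: "0 < h0" "h0 \<le> 1"
    and low: "\<And>k. \<exists>C>0. \<exists>\<delta>>0. \<forall>t\<ge>0. \<bar>t - t0\<bar> < \<delta> \<longrightarrow> \<bar>f t - f t0\<bar> \<le> C * \<bar>t - t0\<bar> powr (\<gamma> k)"
    and \<gamma>: "\<gamma> \<longlonglongrightarrow> h0" "\<And>k. \<gamma> k < h0"
    and up: "\<And>k. \<not> (\<forall>\<^sub>F n in sequentially. \<bar>f (t0 + (1/2) ^ n) - f t0\<bar> \<le> ((1/2) ^ n) powr (\<alpha> k))"
    and \<alpha>: "\<alpha> \<longlonglongrightarrow> h0"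
  shows "pointwise_hoelder_exponent f t0 = h0"
proof -
  let ?O = "hoelder_orders f t0"
  have le: "\<beta> \<le> h0" if \<beta>: "\<beta> \<in> ?O" for \<beta>
  proof (rule ccontr)
    assume "\<not> \<beta> \<le> h0"
    then have "\<forall>\<^sub>F k in sequentially. \<alpha> k < \<beta>" using \<alpha> by (intro order_tendstoD) auto
    then obtain k where k: "\<alpha> k < \<beta>" unfolding eventually_sequentially by blast
    have "(\<lambda>n. t0 + (1/2) ^ n) \<longlonglongrightarrow> t0 + 0" by (intro tendsto_intros LIMSEQ_power_zero) auto
    then have "filterlim (\<lambda>n. t0 + (1/2) ^ n) (at t0 within {0..}) sequentially"
      using t0 by (auto simp: filterlim_at)
    moreover have "((\<lambda>t. \<bar>f t - f t0\<bar> / \<bar>t - t0\<bar> powr \<beta>) \<longlongrightarrow> 0) (at t0 within {0..})"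
      using \<beta> by (simp add: hoelder_orders_def)
    ultimately have "(\<lambda>n. \<bar>f (t0 + (1/2) ^ n) - f t0\<bar> / \<bar>t0 + (1/2) ^ n - t0\<bar> powr \<beta>) \<longlonglongrightarrow> 0"
      by (rule filterlim_compose[rotated])
    then have "\<forall>\<^sub>F n in sequentially. \<bar>f (t0 + (1/2) ^ n) - f t0\<bar> / \<bar>t0 + (1/2) ^ n - t0\<bar> powr \<beta> < 1"
      by (intro order_tendstoD) auto
    then have "\<forall>\<^sub>F n in sequentially. \<bar>f (t0 + (1/2) ^ n) - f t0\<bar> \<le> ((1/2) ^ n) powr (\<alpha> k)"
    proof eventually_elim
      case (elim n)
      then have "\<bar>f (t0 + (1/2) ^ n) - f t0\<bar> \<le> ((1/2) ^ n) powr \<beta>"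
        by (simp add: pos_divide_less_eq)
      also have "\<dots> \<le> ((1/2) ^ n) powr (\<alpha> k)"
        using k by (intro powr_mono') (auto simp: power_le_one)
      finally show ?case .
    qed
    then show False using up by blast
  qed
  have mem: "\<beta> \<in> ?O" if \<beta>: "0 \<le> \<beta>" "\<beta> < h0" for \<beta>
  proof -
    have "\<forall>\<^sub>F k in sequentially. \<beta> < \<gamma> k" using \<gamma>(1) \<beta> by (intro order_tendstoD) auto
    then obtain k where k: "\<beta> < \<gamma> k" unfolding eventually_sequentially by blast
    obtain C \<delta> where C: "C > 0" "\<delta> > 0"
      and bd: "\<And>t. t \<ge> 0 \<Longrightarrow> \<bar>t - t0\<bar> < \<delta> \<Longrightarrow> \<bar>f t - f t0\<bar> \<le> C * \<bar>t - t0\<bar> powr (\<gamma> k)"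
      using low[of k] by blast
    have "((\<lambda>t. \<bar>f t - f t0\<bar> / \<bar>t - t0\<bar> powr \<beta>) \<longlongrightarrow> 0) (at t0 within {0..})"
    proof (rule Lim_null_comparison)
      show "\<forall>\<^sub>F t in at t0 within {0..}. norm (\<bar>f t - f t0\<bar> / \<bar>t - t0\<bar> powr \<beta>) \<le> C * \<bar>t - t0\<bar> powr (\<gamma> k - \<beta>)"
        unfolding eventually_at
      proof (intro exI[of _ \<delta>] conjI ballI impI C(2))
        fix t assume t: "t \<in> {0..}" "t \<noteq> t0 \<and> dist t t0 < \<delta>"
        then have "\<bar>f t - f t0\<bar> / \<bar>t - t0\<bar> powr \<beta> \<le> C * \<bar>t - t0\<bar> powr (\<gamma> k) / \<bar>t - t0\<bar> powr \<beta>"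
          by (intro divide_right_mono bd) (auto simp: dist_real_def)
        then show "norm (\<bar>f t - f t0\<bar> / \<bar>t - t0\<bar> powr \<beta>) \<le> C * \<bar>t - t0\<bar> powr (\<gamma> k - \<beta>)"
          by (simp add: powr_diff)
      qed
      have "((\<lambda>t. C * \<bar>t - t0\<bar> powr (\<gamma> k - \<beta>)) \<longlongrightarrow> C * \<bar>t0 - t0\<bar> powr (\<gamma> k - \<beta>)) (at t0 within {0..})"
        using k by (intro tendsto_intros) auto
      then show "((\<lambda>t. C * \<bar>t - t0\<bar> powr (\<gamma> k - \<beta>)) \<longlongrightarrow> 0) (at t0 within {0..})" by simp
    qed
    then show ?thesis using \<beta> h0 by (simp add: hoelder_orders_def)
  qed
  have ne: "?O \<noteq> {}" using mem[of 0] h0 by auto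
  have "Sup ?O = h0"
  proof (rule antisym)
    show "Sup ?O \<le> h0" using ne le by (rule cSup_least)
    show "h0 \<le> Sup ?O"
    proof (rule dense_le)
      fix x assume "x < h0"
      \<comment> \<open>Orders are nonnegative by definition, so a negative \<open>x\<close> is
        replaced by 0.\<close>
      then have "max x 0 \<in> ?O" using h0 by (intro mem) auto
      then have "max x 0 \<le> Sup ?O" using le by (intro cSup_upper bdd_aboveI) auto
      then show "x \<le> Sup ?O" by simp
    qed
  qed
  then show ?thesis using ne by (simp add: pointwise_hoelder_exponent_def)
qed

subsection \<open>Increments of the limit process\<close>

lemma increment_second_moment:
  fixes S :: "real \<Rightarrow> 'b \<Rightarrow> real"
  assumes P: "prob_space P" and n: "centered_normal_rv P (S s)" "centered_normal_rv P (S t)"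
  shows "(LINT \<omega>|P. (S t \<omega> - S s \<omega>)\<^sup>2) = (LINT \<omega>|P. S t \<omega> * S t \<omega>) - (LINT \<omega>|P. S t \<omega> * S s \<omega>)
    - (LINT \<omega>|P. S s \<omega> * S t \<omega>) + (LINT \<omega>|P. S s \<omega> * S s \<omega>)"
proof -
  have [measurable]: "S s \<in> borel_measurable P" "S t \<in> borel_measurable P"
    using n by (simp_all add: centered_normal_rv_def)
  have sq: "integrable P (\<lambda>\<omega>. S s \<omega> * S s \<omega>)" "integrable P (\<lambda>\<omega>. S t \<omega> * S t \<omega>)"
    using centered_normal_even_moment(1)[OF P n(1), of 1] centered_normal_even_moment(1)[OF P n(2), of 1]
    by (simp_all add: power2_eq_square)
  have "integrable P (\<lambda>\<omega>. S t \<omega> * S s \<omega>)"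
  proof (rule Bochner_Integration.integrable_bound[OF Bochner_Integration.integrable_add[OF sq]])
    have "\<bar>x * y\<bar> \<le> \<bar>y * y + x * x\<bar>" for x y :: real
    proof -
      have "2 * \<bar>x * y\<bar> \<le> x * x + y * y"
        using sum_squares_bound[of "\<bar>x\<bar>" "\<bar>y\<bar>"] by (simp add: abs_mult power2_eq_square mult.assoc)
      then show ?thesis by linarith
    qed
    then show "AE \<omega> in P. norm (S t \<omega> * S s \<omega>) \<le> norm (S s \<omega> * S s \<omega> + S t \<omega> * S t \<omega>)" by simp
  qed measurable
  then show ?thesis using sq
    by (simp add: power2_eq_square algebra_simps)
qed

text \<open>At distances up to 1 a smaller exponent gives a larger power, so a bound
  \<open>m\<close> for \<open>h\<close> on \<open>{s..t}\<close> replaces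
  \<open>h \<theta> + h \<sigma> - 2\<close> by \<open>2 * m - 2\<close>. The constants do not
  depend on \<open>s\<close>, \<open>t\<close> or \<open>m\<close>, except for the factor
  \<open>1 / (2 * m - 1)\<close> from integrating the singularity.\<close>

lemma limit_increment_variance_bounds:
  fixes S :: "real \<Rightarrow> 'b \<Rightarrow> real"
  assumes ab: "1/2 < a" "b < 1"
    and h_range: "\<And>x. h x \<in> {a..b}"
    and h_cont: "continuous_on UNIV h"
    and R_cont: "continuous_on ({a..b} \<times> {a..b}) (\<lambda>(H1, H2). R H1 H2)"
    and R_pos: "\<And>H1 H2. H1 \<in> {a..b} \<Longrightarrow> H2 \<in> {a..b} \<Longrightarrow> R H1 H2 > 0"
    and P: "prob_space P" and S: "\<And>t. t \<ge> 0 \<Longrightarrow> centered_normal_rv P (S t)"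
    and S_cov: "\<And>t s. t \<ge> 0 \<Longrightarrow> s \<ge> 0 \<Longrightarrow> (LINT \<omega>|P. S t \<omega> * S s \<omega>) = limit_covariance R h t s"
  shows "\<exists>B>0. \<exists>c>0.
    (\<forall>s t m. 0 \<le> s \<and> s \<le> t \<and> t \<le> s + 1 \<and> 1/2 < m \<and> (\<forall>x\<in>{s..t}. m \<le> h x) \<longrightarrow>
      (LINT \<omega>|P. (S t \<omega> - S s \<omega>)\<^sup>2) \<le> B / (2 * m - 1) * (t - s) powr (2 * m)) \<and>
    (\<forall>s t m. 0 \<le> s \<and> s < t \<and> t \<le> s + 1 \<and> m \<le> 1 \<and> (\<forall>x\<in>{s..t}. h x \<le> m) \<longrightarrow>
      c * (t - s) powr (2 * m) \<le> (LINT \<omega>|P. (S t \<omega> - S s \<omega>)\<^sup>2))"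
proof -
  let ?Q = "{a..b} \<times> {a..b}"
  have Q: "compact ?Q" "?Q \<noteq> {}" using h_range[of 0] by (auto intro: compact_Times)
  obtain B where B: "\<And>x y. x \<in> {a..b} \<Longrightarrow> y \<in> {a..b} \<Longrightarrow> R x y \<le> B"
    using continuous_attains_sup[OF Q R_cont] by (auto simp: Ball_def)
  obtain c where c: "c > 0" "\<And>x y. x \<in> {a..b} \<Longrightarrow> y \<in> {a..b} \<Longrightarrow> c \<le> R x y"
    using continuous_attains_inf[OF Q R_cont] R_pos by (auto simp: Ball_def) blast
  have B0: "B > 0" using B[OF h_range h_range, of 0 0] R_pos[OF h_range h_range, of 0 0] by linarith
  define K where "K \<theta> \<sigma> = R_sym R \<theta> \<sigma> (h \<theta>) (h \<sigma>) * \<bar>\<theta> - \<sigma>\<bar> powr (h \<theta> + h \<sigma> - 2)" for \<theta> \<sigma>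
  have Rs: "c \<le> R_sym R \<theta> \<sigma> (h \<theta>) (h \<sigma>)" "R_sym R \<theta> \<sigma> (h \<theta>) (h \<sigma>) \<le> B" for \<theta> \<sigma>
    using B[OF h_range h_range] c(2)[OF h_range h_range] by (simp_all add: R_sym_def)
  have K_upper: "K \<theta> \<sigma> \<le> B * \<bar>\<theta> - \<sigma>\<bar> powr (2 * m - 2)"
    if "m \<le> h \<theta>" "m \<le> h \<sigma>" "\<bar>\<theta> - \<sigma>\<bar> \<le> 1" for \<theta> \<sigma> m
    unfolding K_def using that Rs B0 by (intro mult_mono powr_mono') auto
  have K_lower: "c * \<bar>\<theta> - \<sigma>\<bar> powr (2 * m - 2) \<le> K \<theta> \<sigma>"
    if "h \<theta> \<le> m" "h \<sigma> \<le> m" "\<bar>\<theta> - \<sigma>\<bar> \<le> 1" for \<theta> \<sigma> m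
    unfolding K_def using that Rs c(1) order_trans[OF less_imp_le[OF c(1)] Rs(1)]
    by (intro mult_mono powr_mono') auto
  have h_lt: "a \<le> h x" "h x < 1" for x using h_range[of x] ab by auto
  have h_meas[measurable]: "h \<in> borel_measurable borel" using h_cont by (rule borel_measurable_continuous_onI)
  have R_meas: "(\<lambda>(x, y). R (h x) (h y)) \<in> borel_measurable (borel \<Otimes>\<^sub>M borel)"
  proof -
    \<comment> \<open>\<open>R\<close> is continuous only on the square, but \<open>h\<close> maps
      into \<open>{a..b}\<close>, so the composition is continuous on the whole plane.\<close>
    have "continuous_on UNIV (\<lambda>p. (\<lambda>(H1, H2). R H1 H2) (h (fst p), h (snd p)))"
      by (rule continuous_on_compose2[OF R_cont])
         (use h_range in \<open>auto intro!: continuous_intros continuous_on_compose2[OF h_cont]\<close>)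
    then show ?thesis
      unfolding borel_prod by (intro borel_measurable_continuous_onI) (simp add: case_prod_beta)
  qed
  have R1[measurable]: "(\<lambda>p. R (h (fst p)) (h (snd p))) \<in> borel_measurable (borel \<Otimes>\<^sub>M borel)"
    using R_meas by (simp add: case_prod_beta)
  have R2[measurable]: "(\<lambda>p. R (h (snd p)) (h (fst p))) \<in> borel_measurable (borel \<Otimes>\<^sub>M borel)"
    using measurable_compose[OF measurable_pair_swap' R1] by (simp add: case_prod_beta)
  interpret singular_kernel K B "2 * a - 2"
  proof
    show "(\<lambda>(\<theta>, \<sigma>). K \<theta> \<sigma>) \<in> borel_measurable (borel \<Otimes>\<^sub>M borel)"
      unfolding K_def R_sym_def case_prod_beta by measurable
    fix \<theta> \<sigma> :: real
    show "K \<theta> \<sigma> \<ge> 0" unfolding K_def using order_trans[OF less_imp_le[OF c(1)] Rs(1)] by simp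
    show "K \<theta> \<sigma> \<le> B * \<bar>\<theta> - \<sigma>\<bar> powr (2 * a - 2) + B"
    proof (cases "\<bar>\<theta> - \<sigma>\<bar> \<le> 1")
      case True
      then show ?thesis using K_upper[OF h_lt(1) h_lt(1), of \<theta> \<sigma>] B0 by simp
    next
      case False
      \<comment> \<open>Beyond distance 1 the exponent is negative because \<open>h < 1\<close>, so
        the additive constant of the bound suffices.\<close>
      then have "\<bar>\<theta> - \<sigma>\<bar> powr (h \<theta> + h \<sigma> - 2) \<le> \<bar>\<theta> - \<sigma>\<bar> powr 0"
        using h_lt(2)[of \<theta>] h_lt(2)[of \<sigma>] by (intro powr_mono) auto
      also have "\<dots> \<le> 1" by simp
      finally have "K \<theta> \<sigma> \<le> B * 1"
        unfolding K_def using Rs B0 False by (intro mult_mono) auto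
      then show ?thesis using B0 by (simp add: add_increasing)
    qed
  qed (use ab in auto)
  have var: "(LINT \<omega>|P. (S t \<omega> - S s \<omega>)\<^sup>2) = (LINT \<theta>:{s<..t}|lborel. LINT \<sigma>:{s<..t}|lborel. K \<theta> \<sigma>)"
    if "0 \<le> s" "s \<le> t" for s t
  proof -
    have "limit_covariance R h u v = cov u v" for u v by (simp add: limit_covariance_def cov_def K_def)
    then show ?thesis
      using increment_second_moment[where S=S and s=s and t=t, OF P S S] S_cov cov_rectangle[OF that] that by simp
  qed
  show ?thesis
  \<comment> \<open>The 2 counts the two sides of the diagonal in the inner integral.\<close>
  proof (rule exI[of _ "2 * B"], intro exI[of _ c] conjI allI impI)
    show "2 * B > 0" "c > 0" using B0 c by auto
  next
    fix s t m assume *: "0 \<le> s \<and> s \<le> t \<and> t \<le> s + 1 \<and> 1/2 < m \<and> (\<forall>x\<in>{s..t}. m \<le> h x)"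
    then have "K \<theta> \<sigma> \<le> B * \<bar>\<theta> - \<sigma>\<bar> powr (2 * m - 2)" if "\<theta> \<in> {s<..t}" "\<sigma> \<in> {s<..t}" for \<theta> \<sigma>
      using that by (intro K_upper) auto
    then show "(LINT \<omega>|P. (S t \<omega> - S s \<omega>)\<^sup>2) \<le> 2 * B / (2 * m - 1) * (t - s) powr (2 * m)"
      using rectangle_upper[of s t "2 * m - 2" B] var[of s t] * B0 by auto
  next
    fix s t m assume *: "0 \<le> s \<and> s < t \<and> t \<le> s + 1 \<and> m \<le> 1 \<and> (\<forall>x\<in>{s..t}. h x \<le> m)"
    then have "c * \<bar>\<theta> - \<sigma>\<bar> powr (2 * m - 2) \<le> K \<theta> \<sigma>" if "\<theta> \<in> {s<..t}" "\<sigma> \<in> {s<..t}" for \<theta> \<sigma>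
      using that by (intro K_lower) auto
    then show "c * (t - s) powr (2 * m) \<le> (LINT \<omega>|P. (S t \<omega> - S s \<omega>)\<^sup>2)"
      using rectangle_lower[of s t "2 * m - 2" c] var[of s t] * c(1) by auto
  qed
qed

theorem proposition2:
  fixes a b :: real
    and h :: "real \<Rightarrow> real"
    and R :: "real \<Rightarrow> real \<Rightarrow> real"
    and M :: "'a measure"
    and X :: "nat \<Rightarrow> real \<Rightarrow> 'a \<Rightarrow> real"
    and P :: "'b measure"
    and S :: "real \<Rightarrow> 'b \<Rightarrow> real"
  assumes ab: "1/2 < a" "a \<le> b" "b < 1"
    and h_range: "\<And>x. h x \<in> {a..b}"
    and h_cont: "continuous_on UNIV h"
    and R_cont: "continuous_on ({a..b} \<times> {a..b}) (\<lambda>(H1, H2). R H1 H2)"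
    and R_pos: "\<And>H1 H2. H1 \<in> {a..b} \<Longrightarrow> H2 \<in> {a..b} \<Longrightarrow> R H1 H2 > 0"
    and M_prob: "prob_space M"
    and X_gauss: "centered_gaussian_process M (UNIV \<times> {1/2<..<1}) (\<lambda>(n, H). X n H)"
    and cov_bounded: "\<And>C :: real. C > 0 \<Longrightarrow>
      bounded {integral\<^sup>L M (\<lambda>\<omega>. X j H1 \<omega> * X k H2 \<omega>) | j k H1 H2.
        \<bar>real j - real k\<bar> \<le> C \<and> H1 \<in> {a..b} \<and> H2 \<in> {a..b}}"
    and cov_asymp: "((\<lambda>(j, k). SUP (H1, H2)\<in>{a..b} \<times> {a..b}.
        \<bar>(real j - real k) powr (2 - H1 - H2) * integral\<^sup>L M (\<lambda>\<omega>. X j H1 \<omega> * X k H2 \<omega>) - R H1 H2\<bar>)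
      \<longlongrightarrow> 0) (filtercomap (\<lambda>(j, k). real j - real k) at_top)"
    and P_prob: "prob_space P"
    and S_limit: "fdd_converges M (scaled_sum h X) P S {0..}"
    and S_gauss: "centered_gaussian_process P {0..} S"
    and S_cov: "\<And>t s. t \<ge> 0 \<Longrightarrow> s \<ge> 0 \<Longrightarrow>
      integral\<^sup>L P (\<lambda>\<omega>. S t \<omega> * S s \<omega>) = limit_covariance R h t s"
  shows "(\<exists>Y. continuous_modification P S Y) \<and>
    (hoelder_continuous h \<longrightarrow>
      (\<forall>Y. continuous_modification P S Y \<longrightarrow>
        (\<forall>t0\<ge>0. AE \<omega> in P. pointwise_hoelder_exponent (\<lambda>t. Y t \<omega>) t0 = h t0)))"
proof -
  have normal: "centered_normal_rv P (S t)" if "t \<ge> 0" for t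
    using gaussian_process_normal[OF S_gauss] that by simp
  have "\<exists>B>0. \<exists>c>0.
    (\<forall>s t m. 0 \<le> s \<and> s \<le> t \<and> t \<le> s + 1 \<and> 1/2 < m \<and> (\<forall>x\<in>{s..t}. m \<le> h x) \<longrightarrow>
      (LINT \<omega>|P. (S t \<omega> - S s \<omega>)\<^sup>2) \<le> B / (2 * m - 1) * (t - s) powr (2 * m)) \<and>
    (\<forall>s t m. 0 \<le> s \<and> s < t \<and> t \<le> s + 1 \<and> m \<le> 1 \<and> (\<forall>x\<in>{s..t}. h x \<le> m) \<longrightarrow>
      c * (t - s) powr (2 * m) \<le> (LINT \<omega>|P. (S t \<omega> - S s \<omega>)\<^sup>2))"
    by (rule limit_increment_variance_bounds[of a b h R P S])
       (fact ab(1) ab(3) h_range h_cont R_cont R_pos P_prob normal S_cov)+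
  then obtain B c where Bc: "B > 0" "c > 0"
    and upper: "\<And>s t m. 0 \<le> s \<and> s \<le> t \<and> t \<le> s + 1 \<and> 1/2 < m \<and> (\<forall>x\<in>{s..t}. m \<le> h x) \<Longrightarrow>
      (LINT \<omega>|P. (S t \<omega> - S s \<omega>)\<^sup>2) \<le> B / (2 * m - 1) * (t - s) powr (2 * m)"
    and lower: "\<And>s t m. 0 \<le> s \<and> s < t \<and> t \<le> s + 1 \<and> m \<le> 1 \<and> (\<forall>x\<in>{s..t}. h x \<le> m) \<Longrightarrow>
      c * (t - s) powr (2 * m) \<le> (LINT \<omega>|P. (S t \<omega> - S s \<omega>)\<^sup>2)"
    by blast
  have upper_sym: "(LINT \<omega>|P. (S u \<omega> - S v \<omega>)\<^sup>2) \<le> B / (2 * m - 1) * \<bar>u - v\<bar> powr (2 * m)"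
    if "u \<ge> 0" "v \<ge> 0" "\<bar>u - v\<bar> \<le> 1" "1/2 < m" "\<And>x. min u v \<le> x \<Longrightarrow> x \<le> max u v \<Longrightarrow> m \<le> h x" for u v m
  proof (cases "u \<le> v")
    case True
    then show ?thesis using upper[of u v m] that by (simp add: power2_commute[of "S u _"] abs_minus_commute)
  next
    case False
    then show ?thesis using upper[of v u m] that by simp
  qed
  have "\<exists>Y. continuous_modification P S Y"
  proof (rule gaussian_continuous_modification[OF P_prob S_gauss])
    show "(LINT \<omega>|P. (S u \<omega> - S v \<omega>)\<^sup>2) \<le> B / (2 * a - 1) * \<bar>u - v\<bar> powr (2 * a)"
      if "u \<ge> 0" "v \<ge> 0" "\<bar>u - v\<bar> \<le> 1" for u v
      using that ab h_range by (intro upper_sym) auto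
    show "0 \<le> B / (2 * a - 1)" "0 < a" using Bc ab by auto
  qed
  moreover have "AE \<omega> in P. pointwise_hoelder_exponent (\<lambda>t. Y t \<omega>) t0 = h t0"
    if Y: "continuous_modification P S Y" and t0: "t0 \<ge> 0" for Y t0
  proof -
    \<comment> \<open>The divisor is at least 2: thus \<open>h t0 - d k\<close> stays above 1/2, as
      the upper variance bound requires, and \<open>h t0 - 2 * d k\<close> stays positive. Likewise
      \<open>e k\<close> keeps \<open>h t0 + e k\<close> at most 1 for the lower bound.\<close>
    define d where "d k = (h t0 - 1/2) / real (k + 2)" for k
    define e where "e k = (1 - h t0) / real (k + 2)" for k
    have h0: "1/2 < h t0" "h t0 < 1" using h_range[of t0] ab by auto
    have d: "d k > 0" "1/2 < h t0 - d k" "0 < h t0 - 2 * d k" for k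
    proof -
      have "2 * d k \<le> h t0 - 1/2" using h0 mult_left_mono[of 2 "real (k + 2)" "h t0 - 1/2"] by (simp add: d_def pos_divide_le_eq mult.commute)
      moreover show "d k > 0" using h0 by (simp add: d_def)
      ultimately show "1/2 < h t0 - d k" "0 < h t0 - 2 * d k" by linarith+
    qed
    have e: "e k > 0" "h t0 + e k \<le> 1" for k
    proof -
      have "2 * e k \<le> 1 - h t0" using h0 mult_left_mono[of 2 "real (k + 2)" "1 - h t0"] by (simp add: e_def pos_divide_le_eq mult.commute)
      moreover show "e k > 0" using h0 by (simp add: e_def)
      ultimately show "h t0 + e k \<le> 1" by linarith
    qed
    have lim0: "(\<lambda>k. C / real (k + 2)) \<longlonglongrightarrow> 0" for C :: real
      by (rule LIMSEQ_ignore_initial_segment[OF lim_const_over_n])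
    have d_lim: "(\<lambda>k. h t0 - 2 * d k) \<longlonglongrightarrow> h t0"
      using tendsto_diff[OF tendsto_const tendsto_mult_left[OF lim0], of "h t0" 2 "h t0 - 1/2"] by (simp add: d_def)
    have e_lim: "(\<lambda>k. h t0 + 2 * e k) \<longlonglongrightarrow> h t0"
      using tendsto_add[OF tendsto_const tendsto_mult_left[OF lim0], of "h t0" 2 "1 - h t0"] by (simp add: e_def)
    have near: "\<exists>\<delta>>0. \<delta> \<le> 1 \<and> (\<forall>x. \<bar>x - t0\<bar> \<le> \<delta> \<longrightarrow> \<bar>h x - h t0\<bar> \<le> \<epsilon>)" if \<epsilon>: "\<epsilon> > 0" for \<epsilon>
    proof -
      obtain \<delta> where "\<delta> > 0" "\<And>x. \<bar>x - t0\<bar> < \<delta> \<Longrightarrow> \<bar>h x - h t0\<bar> < \<epsilon>"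
        using h_cont \<epsilon> unfolding continuous_on_iff dist_real_def by (metis UNIV_I)
      then show ?thesis by (intro exI[of _ "min 1 (\<delta> / 2)"]) (auto intro!: less_imp_le)
    qed
    \<comment> \<open>One \<open>d k\<close> pays for \<open>h \<ge> h t0 - d k\<close> near
      \<open>t0\<close>, the other for chaining strictly below the variance exponent.\<close>
    have low: "AE \<omega> in P. \<exists>C>0. \<exists>\<delta>>0. \<forall>t\<ge>0. \<bar>t - t0\<bar> < \<delta> \<longrightarrow>
      \<bar>Y t \<omega> - Y t0 \<omega>\<bar> \<le> C * \<bar>t - t0\<bar> powr (h t0 - 2 * d k)" for k
    proof -
      obtain \<delta> where \<delta>: "\<delta> > 0" "\<And>x. \<bar>x - t0\<bar> \<le> \<delta> \<Longrightarrow> \<bar>h x - h t0\<bar> \<le> d k" using near[OF d(1)] by blast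
      show ?thesis
      proof (rule AE_gaussian_hoelder_at[OF P_prob S_gauss Y t0 \<delta>(1)])
        fix u v assume uv: "u \<ge> 0" "v \<ge> 0" "\<bar>u - t0\<bar> \<le> \<delta>" "\<bar>v - t0\<bar> \<le> \<delta>" "\<bar>u - v\<bar> \<le> 1"
        show "(LINT \<omega>|P. (S u \<omega> - S v \<omega>)\<^sup>2) \<le> B / (2 * (h t0 - d k) - 1) * \<bar>u - v\<bar> powr (2 * (h t0 - d k))"
        proof (rule upper_sym[OF uv(1,2,5) d(2)])
          fix x assume "min u v \<le> x" "x \<le> max u v"
          then have "\<bar>x - t0\<bar> \<le> \<delta>" using uv by linarith
          then show "h t0 - d k \<le> h x" using \<delta>(2) by fastforce
        qed
      next
        have "0 < 2 * (h t0 - d k) - 1" using d(2)[of k] by simp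
        then show "0 \<le> B / (2 * (h t0 - d k) - 1)" using Bc by simp
        show "0 < h t0 - 2 * d k" "h t0 - 2 * d k < h t0 - d k" using d[of k] by auto
      qed
    qed
    have up: "AE \<omega> in P. \<not> (\<forall>\<^sub>F n in sequentially. \<bar>S (t0 + (1/2) ^ n) \<omega> - S t0 \<omega>\<bar> \<le> ((1/2) ^ n) powr (h t0 + 2 * e k))" for k
    proof -
      obtain \<delta> where \<delta>: "\<delta> > 0" "\<delta> \<le> 1" "\<And>x. \<bar>x - t0\<bar> \<le> \<delta> \<Longrightarrow> \<bar>h x - h t0\<bar> \<le> e k" using near[OF e(1)] by blast
      show ?thesis
      proof (rule AE_gaussian_irregular_at[OF P_prob S_gauss t0 \<delta>(1) Bc(2)])
        fix t assume t: "t0 < t" "t \<le> t0 + \<delta>"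
        show "c * (t - t0) powr (2 * (h t0 + e k)) \<le> (LINT \<omega>|P. (S t \<omega> - S t0 \<omega>)\<^sup>2)"
        proof (rule lower, intro conjI t0 t(1) e(2) ballI)
          show "t \<le> t0 + 1" using t \<delta> by simp
          fix x assume "x \<in> {t0..t}"
          then have "\<bar>x - t0\<bar> \<le> \<delta>" using t by auto
          then show "h x \<le> h t0 + e k" using \<delta>(3) by fastforce
        qed
      next
        show "h t0 + e k < h t0 + 2 * e k" using e(1)[of k] by simp
      qed
    qed
    have mod: "AE \<omega> in P. Y t \<omega> = S t \<omega>" if "t \<ge> 0" for t
      using Y that by (simp add: continuous_modification_def)
    \<comment> \<open>Irregularity was shown for \<open>S\<close> along one sequence; agreement
      along that sequence and at \<open>t0\<close> transfers it to \<open>Y\<close>.\<close>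
    have "AE \<omega> in P. \<forall>n. Y (t0 + (1/2) ^ n) \<omega> = S (t0 + (1/2) ^ n) \<omega>"
      unfolding AE_all_countable using t0 by (intro allI mod) simp
    moreover have "AE \<omega> in P. \<forall>k. \<exists>C>0. \<exists>\<delta>>0. \<forall>t\<ge>0. \<bar>t - t0\<bar> < \<delta> \<longrightarrow>
      \<bar>Y t \<omega> - Y t0 \<omega>\<bar> \<le> C * \<bar>t - t0\<bar> powr (h t0 - 2 * d k)"
      unfolding AE_all_countable using low by (rule allI)
    moreover have "AE \<omega> in P. \<forall>k. \<not> (\<forall>\<^sub>F n in sequentially. \<bar>S (t0 + (1/2) ^ n) \<omega> - S t0 \<omega>\<bar> \<le> ((1/2) ^ n) powr (h t0 + 2 * e k))"
      unfolding AE_all_countable using up by (rule allI)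
    ultimately show ?thesis using mod[OF t0]
    proof eventually_elim
      case (elim \<omega>)
      show ?case
      proof (rule pointwise_hoelder_exponent_eqI[OF t0 _ _ _ d_lim _ _ e_lim])
        show "0 < h t0" "h t0 \<le> 1" using h0 by auto
        show "h t0 - 2 * d k < h t0" for k using d(1)[of k] by simp
        show "\<exists>C>0. \<exists>\<delta>>0. \<forall>t\<ge>0. \<bar>t - t0\<bar> < \<delta> \<longrightarrow>
          \<bar>Y t \<omega> - Y t0 \<omega>\<bar> \<le> C * \<bar>t - t0\<bar> powr (h t0 - 2 * d k)" for k using elim(2) by blast
        show "\<not> (\<forall>\<^sub>F n in sequentially. \<bar>Y (t0 + (1/2) ^ n) \<omega> - Y t0 \<omega>\<bar> \<le> ((1/2) ^ n) powr (h t0 + 2 * e k))" for k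
          using elim(1,3,4) by simp
      qed
    qed
  qed
  ultimately show ?thesis by blast
qed

end
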